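(* Assume that there is a compactly supported continuous function $M_H:\mathbb{R}\to\mathbb{R}$ such that $$\lim_{T\to\infty}\frac1T\int_0^T \Phi(H(e^t))\,dt=\frac{1}{\sqrt{2\pi}}\int_{\mathbb{R}}M_H(u)\Phi(u)\,du$$ holds for every test function $\Phi:\mathbb{R}\to\mathbb{C}$ which is locally Riemann integrable. Then $H(X)$ is bounded (on $X\ge 1$), and hence the Riemann hypothesis holds.
   Context: For $X\ge 1$, $H(X):=\sum_{\rho}\frac{X^{\rho-1/2}}{\rho(\rho+1)}$, where the (absolutely convergent) sum runs over all nontrivial zeros $\rho$ of the Riemann zeta function $\zeta(s)$ (zeros with $0<\Re(\rho)<1$), counted with multiplicity; $H(X)$ is real-valued. The Riemann hypothesis asserts $\Re(\rho)=1/2$ for all nontrivial zeros. "Locally Riemann integrable" means Riemann integrable on every bounded interval. *)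

theory Defs
  imports "HOL-Complex_Analysis.Complex_Analysis"
begin

text \<open>
  The Riemann zeta function, as the analytic continuation of its Dirichlet series to the plane
  without the point \<open>1\<close>. The value at the pole is irrelevant; fixing it makes the function unique.
\<close>
definition zeta :: "complex \<Rightarrow> complex" where
  "zeta = (THE f. f holomorphic_on (- {1}) \<and>
                  (\<forall>s. Re s > 1 \<longrightarrow> (\<lambda>n. 1 / of_nat (Suc n) powr s) sums f s) \<and>
                  f 1 = 0)"

definition nontrivial_zeros :: "complex set" where
  "nontrivial_zeros = {\<rho>. zeta \<rho> = 0 \<and> 0 < Re \<rho> \<and> Re \<rho> < 1}"

definition riemann_hypothesis :: bool where
  "riemann_hypothesis \<longleftrightarrow> (\<forall>\<rho>\<in>nontrivial_zeros. Re \<rho> = 1 / 2)"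

text \<open>
  The sum is unordered, so absolutely convergent. The factor \<open>zorder zeta \<rho>\<close> is the multiplicity of
  the zero \<open>\<rho>\<close>. The sum is real, because the zeros are symmetric under conjugation; \<open>Re\<close> only
  adjusts the type.
\<close>
definition H :: "real \<Rightarrow> real" where
  "H X = Re (\<Sum>\<^sub>\<infinity>\<rho>\<in>nontrivial_zeros.
               of_int (zorder zeta \<rho>) * (of_real X powr (\<rho> - 1 / 2) / (\<rho> * (\<rho> + 1))))"

text \<open>
  Integrability in the sense of Riemann, not of Henstock and Kurzweil: the Riemann sums converge as
  the mesh tends to \<open>0\<close>.
\<close>
definition riemann_integrable_on ::
    "(real \<Rightarrow> 'a :: real_normed_vector) \<Rightarrow> real \<Rightarrow> real \<Rightarrow> bool" where
  "riemann_integrable_on f a b \<longleftrightarrow>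
     (\<exists>I. \<forall>e>0. \<exists>d>0. \<forall>p. p tagged_division_of {a..b} \<and> (\<forall>(x, K)\<in>p. measure lborel K < d) \<longrightarrow>
        norm ((\<Sum>(x, K)\<in>p. measure lborel K *\<^sub>R f x) - I) < e)"

definition locally_riemann_integrable :: "(real \<Rightarrow> 'a :: real_normed_vector) \<Rightarrow> bool" where
  "locally_riemann_integrable f \<longleftrightarrow> (\<forall>a b. a \<le> b \<longrightarrow> riemann_integrable_on f a b)"

end

(*
  Polya's argument: evaluating the sum over j of (2 cos(pi j/l))^(2m) as a sum of every l-th binomial
  coefficient and letting l^2/m tend to a limit gives the reciprocity of the theta series. Its Mellin
  transform continues zeta and yields an entire xi with xi(0) = 1 and xi(1 - s) = xi(s), bounded by
  exp(O(R log R)) on |s| <= R. Jensen's estimate then makes the sum over the zeros absolutely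
  convergent, so that h(t) = H(e^t) is continuous.

  If h were unbounded, a continuous test function vanishing on the support of M_H and growing fast
  enough along the values of h would have averages that do not tend to 0, although the limit in the
  hypothesis is 0. So h is bounded and its Laplace transform is holomorphic on the right half plane,
  whereas termwise integration gives it a pole at rho - 1/2 for each zero rho with Re rho > 1/2.
  There are thus no such zeros, and the functional equation excludes those with Re rho < 1/2.
*)
theory Submission
  imports Defs "HOL-Real_Asymp.Real_Asymp"
begin

section \<open>Reciprocity of the theta series\<close>

text \<open>\<open>zeta\<close> is a definite description and \<open>H\<close> an unordered sum
  whose value is 0 if it diverges, so neither carries content before the continuation and the
  absolute convergence are established. Convergence rests on counting zeros in large discs, hence on
  the size of xi on whole circles and not only in the strip. The Mellin integral provides it: the
  theta tail is at most a constant times \<open>fact K * exp (- real K * y)\<close> for every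
  \<open>K\<close>, and a \<open>K\<close> proportional to \<open>R\<close> turns the factorial into
  exp(O(R log R)).

  The test function may depend on h, but not on T. An unbounded h has arbitrarily high peaks, yet
  nothing controls where they lie or how narrow they are. Since the growth of the test function is
  at our disposal level by level, it can pay for both.

  The final contradiction needs a genuine pole at each zero off the line. Multiplicities are
  positive, and a conjugate zero contributes with the same denominator, so nothing cancels. Only
  simple poles occur, because multiplicities enter as coefficients.\<close>

lemma cos_power_even_expansion:
  "4 ^ m * cos y ^ (2 * m) =
     (\<Sum>k\<le>2*m. real ((2*m) choose k) * cos (2 * (real k - real m) * y))"
proof -
  have "complex_of_real (4 ^ m * cos y ^ (2 * m)) = (cis y + cis (-y)) ^ (2 * m)"
  proof -
    have "cis y + cis (-y) = complex_of_real (2 * cos y)"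
      by (simp add: complex_eq_iff)
    thus ?thesis by (simp add: power_mult power2_eq_square power_mult_distrib)
  qed
  also have "\<dots> = (\<Sum>k\<le>2*m. of_nat ((2*m) choose k) * cis y ^ k * cis (-y) ^ (2*m-k))"
    by (rule binomial_ring)
  also have "\<dots> = (\<Sum>k\<le>2*m. of_real (real ((2*m) choose k)) * cis (2 * (real k - real m) * y))"
  proof (rule sum.cong)
    fix k assume "k \<in> {..2*m}"
    hence "cis y ^ k * cis (-y) ^ (2*m-k) = cis (2 * (real k - real m) * y)"
      by (simp add: Complex.DeMoivre cis_mult of_nat_diff algebra_simps)
    thus "of_nat ((2*m) choose k) * cis y ^ k * cis (-y) ^ (2*m-k) =
          of_real (real ((2*m) choose k)) * cis (2 * (real k - real m) * y)"
      by (simp add: mult.assoc)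
  qed auto
  finally have "Re (complex_of_real (4 ^ m * cos y ^ (2 * m))) =
      Re (\<Sum>k\<le>2*m. of_real (real ((2*m) choose k)) * cis (2 * (real k - real m) * y))"
    by simp
  thus ?thesis by (simp add: Re_sum del: of_real_mult of_real_power)
qed

text \<open>Telescoping of \<open>2 * sin y * cos (2 * j * y) = sin ((2 * j + 1) * y) - sin ((2 * j
  - 1) * y)\<close>. The product form avoids dividing by \<open>sin y\<close>.\<close>

lemma sin_times_Dirichlet_kernel:
  "sin y * (1 + 2 * (\<Sum>j=1..L. cos (2 * real j * y))) = sin ((2 * real L + 1) * y)"
proof (induction L)
  case (Suc L)
  have "2 * sin y * cos (2 * real (Suc L) * y) = sin ((2 * real (Suc L) + 1) * y) - sin ((2 * real L + 1) * y)"
  proof -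
    have "sin (2 * real (Suc L) * y + y) - sin (2 * real (Suc L) * y - y) = 2 * sin y * cos (2 * real (Suc L) * y)"
      by (simp add: sin_add sin_diff del: of_nat_Suc)
    moreover have "2 * real (Suc L) * y + y = (2 * real (Suc L) + 1) * y"
        "2 * real (Suc L) * y - y = (2 * real L + 1) * y" by (simp_all add: algebra_simps)
    ultimately show ?thesis by simp
  qed
  with Suc show ?case by (simp add: algebra_simps)
qed simp

text \<open>Orthogonality of the \<open>l\<close>-th roots of unity, with \<open>j\<close> and
  \<open>-j\<close> folded together; \<open>l\<close> is odd, so 0 is the only residue paired with
  itself. If \<open>l\<close> does not divide \<open>N\<close>, then \<open>y = N * pi / l\<close>
  is no zero of the sine, while the sine of \<open>l * y = N * pi\<close> vanishes.\<close>

lemma Dirichlet_kernel_root_of_unity: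
  fixes N :: int
  assumes "l = 2 * L + 1"
  shows "1 + 2 * (\<Sum>j=1..L. cos (2 * real_of_int N * (pi * real j / real l))) = (if int l dvd N then real l else 0)"
proof (cases "int l dvd N")
  case True
  then obtain q where q: "N = int l * q" by auto
  have "cos (2 * real_of_int N * (pi * real j / real l)) = 1" for j
  proof -
    have "2 * real_of_int N * (pi * real j / real l) = 2 * pi * of_int (q * int j)"
      using assms by (simp add: q field_simps)
    thus ?thesis using cos_int_2pin by metis
  qed
  thus ?thesis using True assms by simp
next
  case False
  define y where "y = N * pi / real l"
  have "sin y \<noteq> 0"
  proof
    assume "sin y = 0"
    then obtain i :: int where "y = of_int i * pi" by (auto simp: sin_zero_iff_int2)
    hence "real_of_int N * pi = (of_int (i * int l)) * pi" using assms by (simp add: y_def field_simps)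
    hence "real_of_int N = of_int (i * int l)" using pi_neq_zero mult_right_cancel by blast
    hence "N = i * int l" by (simp only: of_int_eq_iff)
    with False show False by simp
  qed
  moreover have "sin ((2 * real L + 1) * y) = 0"
  proof -
    have "(2 * real L + 1) * y = of_int N * pi" using assms by (simp add: y_def field_simps)
    thus ?thesis using sin_zero_iff_int2 by blast
  qed
  moreover have "2 * real_of_int N * (pi * real j / real l) = 2 * real j * y" for j by (simp add: y_def)
  ultimately show ?thesis using sin_times_Dirichlet_kernel[of y L] False by simp
qed

text \<open>Pairing \<open>k\<close> with \<open>2 * m - k\<close> folds the row about its middle
  entry.\<close>

lemma sum_central_binomial_even_function:
  fixes g :: "int \<Rightarrow> real"
  assumes "\<And>r. g (-r) = g r"
  shows "(\<Sum>k\<le>2*m. real ((2*m) choose k) * g (int k - int m)) =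
           real ((2*m) choose m) * g 0 + 2 * (\<Sum>r=1..m. real ((2*m) choose (m + r)) * g (int r))"
proof -
  let ?f = "\<lambda>k. real ((2*m) choose k) * g (int k - int m)"
  have split: "{..2*m} = {..<m} \<union> {m} \<union> {m+1..2*m}" by auto
  have "(\<Sum>k\<le>2*m. ?f k) = (\<Sum>k<m. ?f k) + ?f m + (\<Sum>k=m+1..2*m. ?f k)"
    unfolding split by (subst sum.union_disjoint; (simp; fail)?)+
       (auto simp: sum.union_disjoint)
  also have "(\<Sum>k=m+1..2*m. ?f k) = (\<Sum>r=1..m. real ((2*m) choose (m + r)) * g (int r))"
    by (rule sum.reindex_bij_witness[of _ "\<lambda>r. m + r" "\<lambda>k. k - m"]) auto
  also have "(\<Sum>k<m. ?f k) = (\<Sum>r=1..m. real ((2*m) choose (m + r)) * g (int r))"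
  proof (rule sum.reindex_bij_witness[of _ "\<lambda>r. m - r" "\<lambda>k. m - k"])
    fix k assume k: "k \<in> {..<m}"
    have "(2*m) choose k = (2*m) choose (m + (m - k))"
      using k binomial_symmetric[of k "2*m"] by (simp add: mult_2)
    thus "real ((2*m) choose (m + (m - k))) * g (int (m - k)) = ?f k"
      using k assms[of "int m - int k"] by (simp add: of_nat_diff)
  qed auto
  finally show ?thesis by simp
qed

text \<open>A roots-of-unity filter: summing the cosine powers over the angles
  \<open>pi * j / l\<close> keeps the binomials whose distance from the centre is a multiple of
  \<open>l\<close>. Both sides are discrete theta sums, with terms close to
  \<open>exp (- pi^2 * j^2 * m / l^2)\<close> on the left and \<open>exp (- k^2 * l^2 / m)\<close>
  on the right.\<close>

lemma Polya_identity:
  assumes "l = 2 * L + 1"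
  shows "1 + 2 * (\<Sum>j=1..L. cos (pi * real j / real l) ^ (2 * m)) =
         real l / 4 ^ m * (real ((2*m) choose m) + 2 * (\<Sum>k=1..m. real ((2*m) choose (m + k * l))))"
proof -
  let ?D = "\<lambda>N::int. if int l dvd N then real l else 0"
  have "4 ^ m * (1 + 2 * (\<Sum>j=1..L. cos (pi * real j / real l) ^ (2 * m)))
     = 4 ^ m * cos 0 ^ (2 * m) + 2 * (\<Sum>j=1..L. 4 ^ m * cos (pi * real j / real l) ^ (2 * m))"
    by (simp add: algebra_simps sum_distrib_left)
  also have "\<dots> = (\<Sum>k\<le>2*m. real ((2*m) choose k)) + 2 * (\<Sum>j=1..L. \<Sum>k\<le>2*m. real ((2*m) choose k) *
       cos (2 * (real k - real m) * (pi * real j / real l)))"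
    by (simp only: cos_power_even_expansion) simp
  also have "\<dots> = (\<Sum>k\<le>2*m. real ((2*m) choose k) *
      (1 + 2 * (\<Sum>j=1..L. cos (2 * real_of_int (int k - int m) * (pi * real j / real l)))))"
    by (subst sum.swap) (simp add: algebra_simps sum_distrib_left sum.distrib)
  also have "\<dots> = (\<Sum>k\<le>2*m. real ((2*m) choose k) * ?D (int k - int m))"
    by (simp only: Dirichlet_kernel_root_of_unity[OF assms])
  also have "\<dots> = real ((2*m) choose m) * ?D 0 + 2 * (\<Sum>r=1..m. real ((2*m) choose (m + r)) * ?D (int r))"
    by (rule sum_central_binomial_even_function) simp
  also have "(\<Sum>r=1..m. real ((2*m) choose (m + r)) * ?D (int r)) =
             (\<Sum>k=1..m. real l * real ((2*m) choose (m + k * l)))"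
  proof -
    have l_pos: "l > 0" using assms by simp
    have "(\<Sum>r=1..m. real ((2*m) choose (m + r)) * ?D (int r)) =
          (\<Sum>r\<in>{r\<in>{1..m}. l dvd r}. real l * real ((2*m) choose (m + r)))"
      by (rule sum.mono_neutral_cong_right) auto
    also have "\<dots> = (\<Sum>k\<in>{k\<in>{1..m}. k * l \<le> m}. real l * real ((2*m) choose (m + k * l)))"
    proof (rule sum.reindex_bij_witness[of _ "\<lambda>k. k * l" "\<lambda>r. r div l"])
      fix r assume r: "r \<in> {r\<in>{1..m}. l dvd r}"
      then obtain k where k: "r = l * k" by auto
      show "r div l * l = r" "real l * real ((2*m) choose (m + r div l * l)) = real l * real ((2*m) choose (m + r))"
        using k l_pos by (simp_all add: mult.commute)
      have "k \<le> l * k" using l_pos by simp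
      have "k \<ge> 1" using l_pos r k by (auto simp: Suc_le_eq)
      moreover have "k \<le> m" using le_trans[OF \<open>k \<le> l * k\<close>, of m] r k by simp
      ultimately show "r div l \<in> {k\<in>{1..m}. k * l \<le> m}" using r k l_pos by (auto simp: mult.commute)
    qed (use l_pos in auto)
    \<comment> \<open>Terms with \<open>k * l > m\<close> may be added freely: the lower index then
      exceeds \<open>2 * m\<close> and the binomial is 0.\<close>
    also have "\<dots> = (\<Sum>k=1..m. real l * real ((2*m) choose (m + k * l)))"
      by (rule sum.mono_neutral_left) (auto simp: binomial_eq_0)
    finally show ?thesis .
  qed
  finally show ?thesis by (simp add: field_simps sum_distrib_left)
qed

section \<open>Gaussian shape and size of the central binomial coefficients\<close>

lemma central_binomial_step:
  assumes "r \<le> m"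
  shows "real ((2*m) choose (m + Suc r)) * (real m + real r + 1) = real ((2*m) choose (m + r)) * (real m - real r)"
proof -
  have "Suc (m + r) * ((2*m) choose Suc (m + r)) = (2*m - (m + r)) * ((2*m) choose (m + r))"
    using binomial_absorption[of "m + r" "2*m"] binomial_absorb_comp[of "2*m" "m + r"] by simp
  hence "real (Suc (m + r)) * real ((2*m) choose Suc (m + r)) = real (m - r) * real ((2*m) choose (m + r))"
    by (simp only: of_nat_mult[symmetric]) (simp add: mult_2)
  thus ?thesis using assms by (simp add: of_nat_diff algebra_simps)
qed

text \<open>Each step multiplies by \<open>1 - (2 * r + 1) / (m + r + 1)\<close>, at most
  \<open>exp (- (2 * r + 1) / n)\<close>, and the odd numbers add up to the square. The parameter
  \<open>n\<close> is free because two choices are needed: \<open>n = m + r\<close> for the exact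
  limit and \<open>n = 2 * m\<close> for a bound uniform in \<open>r\<close>.\<close>

lemma central_binomial_ratio_upper:
  assumes "n > 0" "m + r \<le> n"
  shows "real ((2*m) choose (m + r)) \<le> real ((2*m) choose m) * exp (- (real r)\<^sup>2 / real n)"
  using assms(2)
proof (induction r)
  case (Suc r)
  show ?case
  proof (cases "r \<le> m")
    case True
    have "real m + real r + 1 \<le> real n" using Suc.prems by linarith
    have "real ((2*m) choose (m + Suc r)) = real ((2*m) choose (m + r)) * ((real m - real r) / (real m + real r + 1))"
      using central_binomial_step[OF True] by (simp add: field_simps add_pos_nonneg)
    also have "(real m - real r) / (real m + real r + 1) = 1 + (- (2 * real r + 1) / (real m + real r + 1))"
      by (simp add: field_simps add_pos_nonneg)
    also have "\<dots> \<le> exp (- (2 * real r + 1) / (real m + real r + 1))"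
      by (rule exp_ge_add_one_self)
    also have "\<dots> \<le> exp (- (2 * real r + 1) / real n)"
    proof -
      have "(2 * real r + 1) / real n \<le> (2 * real r + 1) / (real m + real r + 1)"
        using \<open>real m + real r + 1 \<le> real n\<close> by (intro frac_le) auto
      thus ?thesis by (simp only: exp_le_cancel_iff minus_divide_left[symmetric] neg_le_iff_le)
    qed
    also have "real ((2*m) choose (m + r)) * exp (- (2 * real r + 1) / real n) \<le>
       (real ((2*m) choose m) * exp (- (real r)\<^sup>2 / real n)) * exp (- (2 * real r + 1) / real n)"
      using Suc by (intro mult_right_mono) auto
    also have "\<dots> = real ((2*m) choose m) * exp (- (real (Suc r))\<^sup>2 / real n)"
      by (simp add: mult_exp_exp mult.assoc power2_eq_square algebra_simps flip: add_divide_distrib diff_divide_distrib)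
    finally show ?thesis by (simp add: mult_left_mono)
  qed (auto simp: binomial_eq_0)
qed auto

text \<open>The step factor is also \<open>1 / (1 + (2 * r + 1) / (m - r))\<close>, which is at
  least \<open>exp (- (2 * r + 1) / (m - r))\<close>; here \<open>m - r\<close> is at least
  \<open>n\<close> at every step.\<close>

lemma central_binomial_ratio_lower:
  assumes "n > 0" "r + n \<le> m"
  shows "real ((2*m) choose (m + r)) \<ge> real ((2*m) choose m) * exp (- (real r)\<^sup>2 / real n)"
  using assms(2)
proof (induction r)
  case (Suc r)
  have r: "real m - real r \<ge> real n" "r \<le> m" using Suc.prems by linarith+
  have n: "real n > 0" using assms by simp
  have "real ((2*m) choose m) * exp (- (real (Suc r))\<^sup>2 / real n) =
      (real ((2*m) choose m) * exp (- (real r)\<^sup>2 / real n)) * exp (- (2 * real r + 1) / real n)"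
    by (simp add: mult_exp_exp mult.assoc power2_eq_square algebra_simps flip: add_divide_distrib diff_divide_distrib)
  also have "\<dots> \<le> real ((2*m) choose (m + r)) * exp (- (2 * real r + 1) / real n)"
    using Suc by (intro mult_right_mono) auto
  also have "exp (- (2 * real r + 1) / real n) \<le> exp (- ((2 * real r + 1) / (real m - real r)))"
  proof -
    have "(2 * real r + 1) / (real m - real r) \<le> (2 * real r + 1) / real n"
      using r n by (intro frac_le) auto
    thus ?thesis by (simp only: exp_le_cancel_iff minus_divide_left[symmetric] neg_le_iff_le)
  qed
  also have "\<dots> = inverse (exp ((2 * real r + 1) / (real m - real r)))" by (rule exp_minus)
  also have "\<dots> \<le> inverse (1 + (2 * real r + 1) / (real m - real r))"
    using r n by (intro le_imp_inverse_le exp_ge_add_one_self add_pos_nonneg divide_nonneg_nonneg) auto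
  also have "\<dots> = (real m - real r) / (real m + real r + 1)"
    using r n by (simp add: divide_simps)
  also have "real ((2*m) choose (m + r)) * \<dots> = real ((2*m) choose (m + Suc r))"
    using central_binomial_step[OF r(2)] by (simp add: field_simps add_pos_nonneg)
  finally show ?case by (simp add: mult_left_mono)
qed auto

text \<open>The quotient of the central binomial by \<open>4 ^ m\<close> is, up to sign, the
  generalized binomial of \<open>-1/2\<close> over \<open>m\<close>, whose asymptotics involve
  \<open>Gamma (1/2) = sqrt pi\<close>. This is the source of the factor
  \<open>sqrt (x / pi)\<close> in the reciprocity.\<close>

lemma central_binomial_asymptotic:
  "(\<lambda>m. real ((2*m) choose m) * sqrt (real m) / 4 ^ m) \<longlonglongrightarrow> 1 / sqrt pi"
proof -
  have *: "((-1/2 :: real) gchoose m) = (-1) ^ m * (real ((2*m) choose m) / 4 ^ m)" for m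
  proof (induction m)
    case (Suc m)
    have "real ((2 * Suc m) choose Suc m) * (real m + 1) = real ((2*m) choose m) * (4 * real m + 2)"
    proof -
      have "Suc m * ((2 * Suc m) choose Suc m) = 2 * (2 * m + 1) * ((2*m) choose m)"
      proof -
        have "Suc m * ((2 * Suc m) choose Suc m) = 2 * Suc m * ((2*m+1) choose m)"
          using Suc_times_binomial_eq[of "2*m+1" m] by simp
        also have "(2*m+1) choose m = (2*m+1) choose (Suc m)"
          using binomial_symmetric[of m "2*m+1"] by simp
        also have "2 * Suc m * ((2*m+1) choose Suc m) = 2 * ((2*m+1) * ((2*m) choose m))"
          using Suc_times_binomial_eq[of "2*m" m] by simp
        finally show ?thesis by simp
      qed
      hence "real (Suc m * ((2 * Suc m) choose Suc m)) = real (2 * (2 * m + 1) * ((2*m) choose m))" by (rule arg_cong)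
      thus ?thesis by (simp add: algebra_simps del: binomial_Suc_Suc mult_Suc_right)
    qed
    hence b: "real ((2 * Suc m) choose Suc m) = real ((2*m) choose m) * (4 * real m + 2) / (real m + 1)"
      by (simp add: field_simps add_pos_nonneg del: binomial_Suc_Suc mult_Suc_right)
    have "((-1/2 :: real) gchoose Suc m) = ((-1/2) gchoose m) * ((-1/2 - real m) / (real m + 1))"
      by (simp add: gbinomial_Suc_rec gbinomial_absorption' field_simps gbinomial_prod_rev prod.lessThan_Suc)
    also have "\<dots> = (-1) ^ Suc m * (real ((2 * Suc m) choose Suc m) / 4 ^ Suc m)"
    proof -
      define F where "F = (4 * real m + 2) / (real m + 1)"
      have "(-1/2 - real m) / (real m + 1) = - F / 4"
        by (simp add: F_def divide_simps) (simp add: algebra_simps)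
      moreover have "u * (B / p) * (- F / 4) = - u * (B * F / (4 * p))" for u B p :: real by simp
      ultimately show ?thesis unfolding b Suc.IH times_divide_eq_right[symmetric] F_def[symmetric] by simp
    qed
    finally show ?case .
  qed simp
  have "(\<lambda>n. ((-1/2 :: real) gchoose n) / ((-1)^n / exp ((-1/2+1) * of_real (ln (real n))))) \<longlonglongrightarrow> inverse (Gamma (- (-1/2)))"
    by (rule gbinomial_asymptotic)
  also have "inverse (Gamma (- (-1/2 :: real))) = 1 / sqrt pi"
    using Gamma_one_half_real by (simp add: field_simps)
  finally show ?thesis
  proof (rule Lim_transform_eventually)
    show "\<forall>\<^sub>F n in sequentially. ((-1/2 :: real) gchoose n) / ((-1)^n / exp ((-1/2+1) * of_real (ln (real n)))) =
        real ((2*n) choose n) * sqrt (real n) / 4 ^ n"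
      using eventually_gt_at_top[of 0]
    proof eventually_elim
      case (elim n)
      have "exp ((-1/2+1) * ln (real n)) = sqrt (real n)"
        using elim by (simp add: powr_half_sqrt[symmetric] powr_def)
      moreover have "(-1::real) ^ n * (-1) ^ n = 1" by (simp flip: power_mult_distrib)
      ultimately show ?case unfolding * by (simp add: field_simps)
    qed
  qed
qed

text \<open>The derivative of \<open>exp (u^2 / 2) * cos u\<close> has the sign of
  \<open>u * cos u - sin u\<close>, which itself decreases from 0. The estimate supplies the
  dominating series on the cosine side.\<close>

lemma cos_le_exp_square:
  fixes y :: real
  assumes "0 \<le> y" "y \<le> pi / 2"
  shows "cos y \<le> exp (- y\<^sup>2 / 2)"
proof -
  have "u * cos u - sin u \<le> 0 * cos 0 - sin 0" if "0 \<le> u" "u \<le> pi / 2" for u :: real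
  proof (rule DERIV_nonpos_imp_nonincreasing[where f = "\<lambda>u. u * cos u - sin u"])
    show "\<exists>d. ((\<lambda>u. u * cos u - sin u) has_real_derivative d) (at x) \<and> d \<le> 0"
      if "0 \<le> x" "x \<le> u" for x
      using that \<open>u \<le> pi / 2\<close> pi_gt_zero
      by (intro exI[of _ "- (x * sin x)"] conjI)
         (auto intro!: derivative_eq_intros mult_nonneg_nonneg sin_ge_zero)
  qed fact
  hence tan: "u * cos u \<le> sin u" if "0 \<le> u" "u \<le> pi / 2" for u :: real using that by fastforce
  have "exp (y\<^sup>2 / 2) * cos y \<le> exp (0\<^sup>2 / 2) * cos 0"
  proof (rule DERIV_nonpos_imp_nonincreasing[where f = "\<lambda>u. exp (u\<^sup>2 / 2) * cos u"])
    show "\<exists>d. ((\<lambda>u. exp (u\<^sup>2 / 2) * cos u) has_real_derivative d) (at x) \<and> d \<le> 0"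
      if "0 \<le> x" "x \<le> y" for x
    proof (intro exI conjI)
      show "((\<lambda>u. exp (u\<^sup>2 / 2) * cos u) has_real_derivative exp (x\<^sup>2 / 2) * (x * cos x - sin x)) (at x)"
        by (auto intro!: derivative_eq_intros simp: algebra_simps)
      show "exp (x\<^sup>2 / 2) * (x * cos x - sin x) \<le> 0"
        using tan[of x] that assms by (intro mult_nonneg_nonpos) auto
    qed
  qed fact
  thus ?thesis by (simp add: exp_minus field_simps)
qed

lemma summable_exp_times_Suc:
  fixes c :: real
  assumes "c > 0"
  shows "summable (\<lambda>n. exp (- c * real (Suc n)))"
proof -
  have "summable (\<lambda>n. exp (- c) * exp (- c) ^ n)"
    using assms by (intro summable_mult summable_geometric) auto
  thus ?thesis by (simp add: exp_of_nat_mult[symmetric] mult_exp_exp algebra_simps)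
qed

lemma suminf_finite_Suc:
  fixes f :: "nat \<Rightarrow> real"
  shows "(\<Sum>n. if n < N then f (Suc n) else 0) = (\<Sum>k=1..N. f k)"
proof -
  have "(\<Sum>n. if n < N then f (Suc n) else 0) = (\<Sum>n<N. if n < N then f (Suc n) else 0)"
    by (rule suminf_finite) auto
  also have "\<dots> = (\<Sum>k=1..N. f k)"
    by (rule sum.reindex_bij_witness[of _ "\<lambda>k. k - 1" Suc]) auto
  finally show ?thesis .
qed

text \<open>Limit of \<open>Polya_identity\<close> as \<open>l^2 / m\<close> tends to
  \<open>x\<close>, by Tannery's theorem on both sides. With \<open>x = pi * t\<close> it is
  Jacobi's transformation between \<open>t\<close> and \<open>1 / t\<close>.\<close>

theorem theta_reciprocity:
  fixes x :: real
  assumes x: "x > 0"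
  shows "1 + 2 * (\<Sum>n. exp (- pi\<^sup>2 * (real (Suc n))\<^sup>2 / x)) =
         sqrt (x / pi) * (1 + 2 * (\<Sum>n. exp (- x * (real (Suc n))\<^sup>2)))"
proof -
  define l where "l = (\<lambda>L::nat. 2 * L + 1)"
  \<comment> \<open>The floor makes \<open>l^2 / m\<close> tend to \<open>x\<close>;
    \<open>l\<close> runs through the odd numbers, as the identity requires.\<close>
  define m where "m = (\<lambda>L::nat. nat \<lfloor>(real (l L))\<^sup>2 / x\<rfloor>)"
  have l_pos: "l L > 0" for L by (simp add: l_def)
  have "(\<lambda>L. real (m L) / (real (l L))\<^sup>2) \<longlonglongrightarrow> inverse x"
    unfolding m_def l_def using x by real_asymp
  hence ml: "(\<lambda>L. real (m L) / (real (l L))\<^sup>2) \<longlonglongrightarrow> 1 / x"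
    by (simp add: inverse_eq_divide)
  have lm: "(\<lambda>L. (real (l L))\<^sup>2 / real (m L)) \<longlonglongrightarrow> x"
    using tendsto_inverse[OF ml] x by (simp add: inverse_eq_divide)
  have m_top: "filterlim m at_top sequentially"
    unfolding m_def l_def using x by real_asymp

  \<comment> \<open>Finite sums are written as series by padding with 0. The index is shifted:
    \<open>n\<close> stands for the term with number \<open>Suc n\<close>.\<close>
  define a where "a = (\<lambda>n L. if n < L then cos (pi * real (Suc n) / real (l L)) ^ (2 * m L) else 0)"
  define b where "b = (\<lambda>n L. if n < m L then real ((2 * m L) choose (m L + Suc n * l L)) / real ((2 * m L) choose m L) else 0)"
  define c where "c = (\<lambda>L. real (l L) / 4 ^ m L * real ((2 * m L) choose m L))"

  have ev1: "\<forall>\<^sub>F L in sequentially. real (m L) / (real (l L))\<^sup>2 > 1 / (2 * x)"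
    using order_tendstoD(1)[OF ml, of "1 / (2 * x)"] x by (simp add: field_simps)
  have ev2: "\<forall>\<^sub>F L in sequentially. (real (l L))\<^sup>2 / real (m L) > x / 2"
    using order_tendstoD(1)[OF lm, of "x / 2"] x by simp
  have ev3: "\<forall>\<^sub>F L in sequentially. m L > 0"
    using eventually_compose_filterlim[OF eventually_gt_at_top m_top] .

  have eq: "1 + 2 * (\<Sum>n. a n L) = c L * (1 + 2 * (\<Sum>n. b n L))" for L
  proof -
    have "1 + 2 * (\<Sum>n. a n L) = 1 + 2 * (\<Sum>j=1..L. cos (pi * real j / real (l L)) ^ (2 * m L))"
      unfolding a_def by (subst suminf_finite_Suc) simp
    also have "\<dots> = real (l L) / 4 ^ m L * (real ((2*m L) choose m L) +
        2 * (\<Sum>k=1..m L. real ((2*m L) choose (m L + k * l L))))"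
      by (rule Polya_identity) (simp add: l_def)
    also have "(\<Sum>k=1..m L. real ((2*m L) choose (m L + k * l L))) = real ((2*m L) choose m L) * (\<Sum>n. b n L)"
      unfolding b_def by (subst suminf_finite_Suc) (simp add: sum_distrib_left)
    finally show ?thesis by (simp add: c_def algebra_simps add_divide_distrib)
  qed

  have a_lim: "(\<lambda>L. \<Sum>n. a n L) \<longlonglongrightarrow> (\<Sum>n. exp (- pi\<^sup>2 * (real (Suc n))\<^sup>2 / x))"
  proof -
    have 1: "(a n \<longlongrightarrow> exp (- pi\<^sup>2 * (real (Suc n))\<^sup>2 / x)) sequentially" for n
    proof -
      define p where "p = pi * real (Suc n)"
      have p: "p > 0" by (simp add: p_def)
      \<comment> \<open>The squared cosine is used because its logarithm needs only a non-zero
        cosine; the exponent \<open>2 * m\<close> is then the exponent \<open>m\<close> of the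
        square.\<close>
      have "(\<lambda>L. (real (l L))\<^sup>2 * ln (cos (p / real (l L)) ^ 2)) \<longlonglongrightarrow> - p\<^sup>2"
        unfolding l_def power2_eq_square[of p] using p by real_asymp
      hence "(\<lambda>L. exp ((real (m L) / (real (l L))\<^sup>2) * ((real (l L))\<^sup>2 * ln (cos (p / real (l L)) ^ 2)))) \<longlonglongrightarrow> exp (1 / x * (- p\<^sup>2))"
        by (intro tendsto_intros ml)
      moreover have "\<forall>\<^sub>F L in sequentially. exp ((real (m L) / (real (l L))\<^sup>2) * ((real (l L))\<^sup>2 * ln (cos (p / real (l L)) ^ 2))) = a n L"
      proof -
        have "(\<lambda>L. cos (p / real (l L)) ^ 2) \<longlonglongrightarrow> 1"
          unfolding l_def using p by real_asymp
        from order_tendstoD(1)[OF this, of 0]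
        have "\<forall>\<^sub>F L in sequentially. cos (p / real (l L)) ^ 2 > 0" by simp
        thus ?thesis using eventually_gt_at_top[of n]
        proof eventually_elim
          case (elim L)
          have "exp (real (m L) * ln (cos (p / real (l L)) ^ 2)) = (cos (p / real (l L)) ^ 2) ^ m L"
            using elim by (simp add: exp_of_nat_mult del: zero_less_power2)
          thus ?case using elim l_pos[of L] by (simp add: a_def p_def power_mult)
        qed
      qed
      ultimately have "(a n \<longlongrightarrow> exp (1 / x * (- p\<^sup>2))) sequentially"
        by (rule Lim_transform_eventually)
      thus ?thesis by (simp add: p_def power_mult_distrib)
    qed
    \<comment> \<open>From \<open>cos y \<le> exp (- y^2 / 2)\<close> to the power
      \<open>2 * m\<close>, with \<open>m / l^2 > 1 / (2 * x)\<close> by \<open>ev1\<close> and the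
      square of \<open>Suc n\<close> replaced by \<open>Suc n\<close>.\<close>
    define C where "C = pi\<^sup>2 / (2 * x)"
    have "C > 0" using x by (simp add: C_def)
    have 2: "\<forall>\<^sub>F (n, L) in at_top \<times>\<^sub>F sequentially. norm (a n L) \<le> exp (- C * real (Suc n))"
    proof -
      have "\<forall>\<^sub>F L in sequentially. \<forall>n. norm (a n L) \<le> exp (- C * real (Suc n))"
        using ev1
      proof eventually_elim
        case (elim L)
        show ?case
        proof
          fix n
          show "norm (a n L) \<le> exp (- C * real (Suc n))"
          proof (cases "n < L")
            case True
            define y where "y = pi * real (Suc n) / real (l L)"
            have y: "0 \<le> y" "y \<le> pi / 2"
            proof -
              have "2 * real (Suc n) \<le> real (l L)" using True by (simp add: l_def)
              hence "pi * (2 * real (Suc n)) \<le> pi * real (l L)" by (intro mult_left_mono) auto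
              thus "y \<le> pi / 2" using l_pos[of L] by (simp add: y_def field_simps)
            qed (simp add: y_def)
            have "norm (a n L) = cos y ^ (2 * m L)"
              using True by (simp add: a_def y_def power_mult)
            also have "\<dots> \<le> exp (- y\<^sup>2 / 2) ^ (2 * m L)"
              using y by (intro power_mono cos_le_exp_square cos_ge_zero) auto
            also have "\<dots> = exp (- (pi\<^sup>2 * (real (Suc n))\<^sup>2 * (real (m L) / (real (l L))\<^sup>2)))"
              by (simp add: exp_of_nat_mult[symmetric] y_def power_divide power_mult_distrib)
            also have "\<dots> \<le> exp (- (pi\<^sup>2 * real (Suc n) * (1 / (2 * x))))"
            proof -
              have "real (Suc n) \<le> (real (Suc n))\<^sup>2" by (simp add: power2_eq_square)
              hence "pi\<^sup>2 * real (Suc n) * (1 / (2 * x)) \<le> pi\<^sup>2 * (real (Suc n))\<^sup>2 * (real (m L) / (real (l L))\<^sup>2)"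
                using elim x by (intro mult_mono) auto
              thus ?thesis by simp
            qed
            finally show ?thesis by (simp add: C_def)
          qed (simp add: a_def)
        qed
      qed
      from eventually_compose_filterlim[OF this filterlim_snd[of at_top]]
      show ?thesis by (rule eventually_mono) auto
    qed
    show ?thesis
      using tannerys_theorem[OF 1 2 summable_exp_times_Suc[OF \<open>C > 0\<close>]] by simp
  qed

  have b_lim: "(\<lambda>L. \<Sum>n. b n L) \<longlonglongrightarrow> (\<Sum>n. exp (- x * (real (Suc n))\<^sup>2))"
  proof -
    have 1: "(b n \<longlongrightarrow> exp (- x * (real (Suc n))\<^sup>2)) sequentially" for n
    proof (rule tendsto_sandwich)
      \<comment> \<open>The two ratio bounds have the denominators \<open>m + r\<close> and
        \<open>m - r\<close> in the exponent. Since \<open>r / m\<close> tends to 0 and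
        \<open>r^2 / m\<close> to \<open>x\<close> times the square of \<open>Suc n\<close>, they
        squeeze to the same limit.\<close>
      define r where "r = (\<lambda>L. Suc n * l L)"
      have rm: "(\<lambda>L. real (r L) / real (m L)) \<longlonglongrightarrow> 0"
        unfolding r_def m_def l_def using x by real_asymp
      have r2m: "(\<lambda>L. (real (r L))\<^sup>2 / real (m L)) \<longlonglongrightarrow> (real (Suc n))\<^sup>2 * x"
        using tendsto_mult_left[OF lm, of "(real (Suc n))\<^sup>2"] by (simp only: r_def of_nat_mult power_mult_distrib times_divide_eq_right)
      have ev4: "\<forall>\<^sub>F L in sequentially. r L < m L"
        using order_tendstoD(2)[OF rm zero_less_one] ev3 by eventually_elim simp
      have ev5: "\<forall>\<^sub>F L in sequentially. m L > n"
        using eventually_compose_filterlim[OF eventually_gt_at_top m_top] .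
      have pos: "real ((2 * m L) choose m L) > 0" for L by simp
      show "\<forall>\<^sub>F L in sequentially. b n L \<le> exp (- ((real (r L))\<^sup>2 / real (m L)) / (1 + real (r L) / real (m L)))"
        using ev3 ev5
      proof eventually_elim
        case (elim L)
        have "b n L \<le> exp (- (real (r L))\<^sup>2 / real (m L + r L))"
          using central_binomial_ratio_upper[of "m L + r L" "m L" "r L"] elim pos[of L]
          by (simp add: b_def r_def divide_simps mult.commute)
        also have "- (real (r L))\<^sup>2 / real (m L + r L) = - ((real (r L))\<^sup>2 / real (m L)) / (1 + real (r L) / real (m L))"
          using elim by (simp add: field_simps)
        finally show ?case .
      qed
      show "\<forall>\<^sub>F L in sequentially. exp (- ((real (r L))\<^sup>2 / real (m L)) / (1 - real (r L) / real (m L))) \<le> b n L"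
        using ev3 ev4 ev5
      proof eventually_elim
        case (elim L)
        have "- ((real (r L))\<^sup>2 / real (m L)) / (1 - real (r L) / real (m L)) = - (real (r L))\<^sup>2 / real (m L - r L)"
          using elim by (simp add: field_simps of_nat_diff)
        also have "exp \<dots> \<le> b n L"
          using central_binomial_ratio_lower[of "m L - r L" "r L" "m L"] elim pos[of L]
          by (simp add: b_def r_def divide_simps mult.commute)
        finally show ?case .
      qed
      have "(\<lambda>L. exp (- ((real (r L))\<^sup>2 / real (m L)) / (1 + real (r L) / real (m L)))) \<longlonglongrightarrow> exp (- ((real (Suc n))\<^sup>2 * x) / (1 + 0))"
        by (intro tendsto_intros rm r2m) auto
      thus "(\<lambda>L. exp (- ((real (r L))\<^sup>2 / real (m L)) / (1 + real (r L) / real (m L)))) \<longlonglongrightarrow> exp (- x * (real (Suc n))\<^sup>2)"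
        by (simp add: mult.commute)
      have "(\<lambda>L. exp (- ((real (r L))\<^sup>2 / real (m L)) / (1 - real (r L) / real (m L)))) \<longlonglongrightarrow> exp (- ((real (Suc n))\<^sup>2 * x) / (1 - 0))"
        by (intro tendsto_intros rm r2m) auto
      thus "(\<lambda>L. exp (- ((real (r L))\<^sup>2 / real (m L)) / (1 - real (r L) / real (m L)))) \<longlonglongrightarrow> exp (- x * (real (Suc n))\<^sup>2)"
        by (simp add: mult.commute)
    qed
    \<comment> \<open>The upper ratio bound with \<open>n = 2 * m\<close> gives half of
      \<open>l^2 / m\<close>, and \<open>ev2\<close> bounds that quotient below by
      \<open>x / 2\<close>.\<close>
    define C where "C = x / 4"
    have "C > 0" using x by (simp add: C_def)
    have 2: "\<forall>\<^sub>F (n, L) in at_top \<times>\<^sub>F sequentially. norm (b n L) \<le> exp (- C * real (Suc n))"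
    proof -
      have "\<forall>\<^sub>F L in sequentially. \<forall>n. norm (b n L) \<le> exp (- C * real (Suc n))"
        using ev2 ev3
      proof eventually_elim
        case (elim L)
        show ?case
        proof
          fix n
          define r where "r = Suc n * l L"
          show "norm (b n L) \<le> exp (- C * real (Suc n))"
          proof (cases "n < m L \<and> r \<le> m L")
            case True
            have pos: "real ((2 * m L) choose m L) > 0" by simp
            have "norm (b n L) = b n L" by (simp add: b_def)
            also have "\<dots> \<le> exp (- (real r)\<^sup>2 / real (2 * m L))"
              using central_binomial_ratio_upper[of "2 * m L" "m L" r] True elim pos
              by (simp add: b_def r_def divide_simps mult.commute)
            also have "\<dots> = exp (- ((real (Suc n))\<^sup>2 * ((real (l L))\<^sup>2 / real (m L)) / 2))"
              by (simp only: r_def of_nat_mult power_mult_distrib times_divide_eq_right times_divide_eq_left) simp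
            also have "\<dots> \<le> exp (- (real (Suc n) * (x / 2) / 2))"
            proof -
              have "real (Suc n) \<le> (real (Suc n))\<^sup>2" by (simp add: power2_eq_square)
              hence "real (Suc n) * (x / 2) \<le> (real (Suc n))\<^sup>2 * ((real (l L))\<^sup>2 / real (m L))"
                using elim x by (intro mult_mono) auto
              thus ?thesis by (simp add: mult_ac)
            qed
            finally show ?thesis by (simp add: C_def mult_ac)
          next
            case False
            hence "b n L = 0" by (auto simp: b_def r_def binomial_eq_0)
            thus ?thesis by simp
          qed
        qed
      qed
      from eventually_compose_filterlim[OF this filterlim_snd[of at_top]]
      show ?thesis by (rule eventually_mono) auto
    qed
    show ?thesis
      using tannerys_theorem[OF 1 2 summable_exp_times_Suc[OF \<open>C > 0\<close>]] by simp
  qed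

  have c_lim: "c \<longlonglongrightarrow> sqrt (x / pi)"
  proof -
    have "(\<lambda>L. sqrt ((real (l L))\<^sup>2 / real (m L)) *
           (real ((2 * m L) choose m L) * sqrt (real (m L)) / 4 ^ m L)) \<longlonglongrightarrow> sqrt x * (1 / sqrt pi)"
      by (intro tendsto_mult tendsto_real_sqrt lm filterlim_compose[OF central_binomial_asymptotic m_top])
    moreover have "\<forall>\<^sub>F L in sequentially. sqrt ((real (l L))\<^sup>2 / real (m L)) *
           (real ((2 * m L) choose m L) * sqrt (real (m L)) / 4 ^ m L) = c L"
      using ev3 by eventually_elim (simp add: c_def real_sqrt_divide)
    ultimately have "c \<longlonglongrightarrow> sqrt x * (1 / sqrt pi)" by (rule Lim_transform_eventually)
    thus ?thesis by (simp add: real_sqrt_divide)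
  qed

  have "(\<lambda>L. 1 + 2 * (\<Sum>n. a n L)) \<longlonglongrightarrow> 1 + 2 * (\<Sum>n. exp (- pi\<^sup>2 * (real (Suc n))\<^sup>2 / x))"
    by (intro tendsto_intros a_lim)
  moreover have "(\<lambda>L. 1 + 2 * (\<Sum>n. a n L)) \<longlonglongrightarrow> sqrt (x / pi) * (1 + 2 * (\<Sum>n. exp (- x * (real (Suc n))\<^sup>2)))"
    unfolding eq by (intro tendsto_intros b_lim c_lim)
  ultimately show ?thesis by (rule LIMSEQ_unique)
qed

section \<open>Fourier--Laplace integrals over a half line\<close>

lemma set_lborel_exp_minus_at_least:
  fixes k c :: real
  assumes "k > 0"
  shows "set_integrable lborel {c..} (\<lambda>y. exp (- k * y))"
    and "(LINT y:{c..}|lborel. exp (- k * y)) = exp (- k * c) / k"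
proof -
  note hi = has_integral_exp_minus_to_infinity[OF assms, of c]
  have "(\<lambda>y. exp (- k * y)) absolutely_integrable_on {c..}"
    using hi by (intro nonnegative_absolutely_integrable_1) auto
  thus *: "set_integrable lborel {c..} (\<lambda>y. exp (- k * y))"
    unfolding set_integrable_def by (subst (asm) integrable_completion) auto
  show "(LINT y:{c..}|lborel. exp (- k * y)) = exp (- k * c) / k"
    using set_borel_integral_eq_integral(2)[OF *] hi by (simp add: integral_unique)
qed

text \<open>Used with \<open>c = 0\<close> for the existence of a transform, and with large
  \<open>c\<close> to make the tail of the integral small.\<close>

lemma set_lborel_dominated_exp_minus:
  fixes f :: "real \<Rightarrow> complex" and k c :: real
  assumes "k > 0" "continuous_on {c..} f" "\<And>y. y \<ge> c \<Longrightarrow> norm (f y) \<le> C * exp (- k * y)"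
  shows "set_integrable lborel {c..} f"
    and "norm (LINT y:{c..}|lborel. f y) \<le> C * exp (- k * c) / k"
proof -
  have C: "C \<ge> 0"
    using order.trans[OF norm_ge_zero assms(3)[of c]] by (simp add: zero_le_mult_iff)
  have m: "set_borel_measurable lborel {c..} f"
    unfolding set_borel_measurable_def
    using borel_measurable_continuous_on_indicator[OF _ assms(2)] by simp
  have e: "set_integrable lborel {c..} (\<lambda>y. C * exp (- k * y))"
    using set_lborel_exp_minus_at_least(1)[OF assms(1)] by simp
  show i: "set_integrable lborel {c..} f"
    by (rule set_integrable_bound[OF e m]) (use assms(3) C in \<open>auto simp: abs_mult\<close>)
  have "norm (LINT y:{c..}|lborel. f y) \<le> (LINT y:{c..}|lborel. norm (f y))"
    by (rule set_integral_norm_bound[OF i])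
  also have "\<dots> \<le> (LINT y:{c..}|lborel. C * exp (- k * y))"
    using assms(3) by (intro set_integral_mono set_integrable_norm i e) auto
  also have "\<dots> = C * exp (- k * c) / k"
    using set_lborel_exp_minus_at_least(2)[OF assms(1), of c] by simp
  finally show "norm (LINT y:{c..}|lborel. f y) \<le> C * exp (- k * c) / k" .
qed

text \<open>The integrals over \<open>{0..n}\<close> are holomorphic by differentiation under the
  integral sign, and they converge locally uniformly. The kernel is \<open>exp (s * y)\<close> with
  a plus sign, so convergence holds to the left of \<open>a\<close>. The theta transform uses it
  with every natural \<open>a\<close>, the bounded function h with \<open>a = 0\<close>.\<close>

lemma holomorphic_on_half_line_transform:
  fixes g :: "real \<Rightarrow> complex"
  assumes cont: "continuous_on {0..} g"
    and bound: "\<And>y. y \<ge> 0 \<Longrightarrow> norm (g y) \<le> C * exp (- a * y)"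
  shows "(\<lambda>s. LINT y:{0..}|lborel. g y * exp (s * y)) holomorphic_on {s. Re s < a}"
proof (rule holomorphic_uniform_sequence)
  show "open {s. Re s < a}" by (rule open_halfspace_Re_lt)
  define f where "f = (\<lambda>n::nat. \<lambda>s::complex. integral (cbox 0 (real n)) (\<lambda>y. g y * exp (s * y)))"
  have cn: "continuous_on (cbox 0 (real n)) g" for n
    by (rule continuous_on_subset[OF cont]) auto
  show "f n holomorphic_on {s. Re s < a}" for n
    unfolding f_def
  proof (rule leibniz_rule_holomorphic[where fx = "\<lambda>s y. g y * y * exp (s * y)"])
    show "convex {s. Re s < a}" by (rule convex_halfspace_Re_lt)
    show "((\<lambda>s. g y * exp (s * y)) has_field_derivative g y * y * exp (s * y)) (at s within {s. Re s < a})" for s :: complex and y :: real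
      by (auto intro!: derivative_eq_intros)
    show "(\<lambda>y. g y * exp (s * y)) integrable_on cbox 0 (real n)" for s :: complex
      by (intro integrable_continuous continuous_intros cn)
    have "continuous_on ({s. Re s < a} \<times> cbox 0 (real n)) (\<lambda>p. g (snd p))"
      by (rule continuous_on_compose2[OF cn continuous_on_snd[OF continuous_on_id]]) auto
    thus "continuous_on ({s. Re s < a} \<times> cbox 0 (real n)) (\<lambda>(s, y). g y * complex_of_real y * exp (s * complex_of_real y))"
      by (auto simp: case_prod_unfold intro!: continuous_intros)
  qed
  have C: "C \<ge> 0" using order.trans[OF norm_ge_zero bound[of 0]] by simp
  fix x assume "x \<in> {s. Re s < a}"
  \<comment> \<open>Half the distance to the boundary line: on the disc of this radius the integrand
    still decays at rate \<open>d\<close>.\<close>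
  define d where "d = (a - Re x) / 2"
  have d: "d > 0" using \<open>x \<in> _\<close> by (simp add: d_def)
  have Re_le: "Re s \<le> a - d" if "s \<in> cball x d" for s
  proof -
    have "Re s - Re x \<le> norm (s - x)" using complex_Re_le_cmod[of "s - x"] by simp
    also have "\<dots> \<le> d" using that by (simp add: dist_norm norm_minus_commute)
    finally show ?thesis by (simp add: d_def field_simps)
  qed
  have gb: "norm (g y * exp (s * y)) \<le> C * exp (- d * y)" if "s \<in> cball x d" "y \<ge> 0" for s y
  proof -
    have "norm (g y * exp (s * y)) \<le> (C * exp (- a * y)) * exp (Re s * y)"
      using bound[OF that(2)] by (simp add: norm_mult mult_right_mono)
    also have "\<dots> \<le> (C * exp (- a * y)) * exp ((a - d) * y)"
      using Re_le[OF that(1)] that(2) C by (intro mult_left_mono) (auto intro: mult_right_mono)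
    also have "\<dots> = C * exp (- d * y)" by (simp add: mult_exp_exp algebra_simps)
    finally show ?thesis .
  qed
  have gc: "continuous_on {c..} (\<lambda>y. g y * exp (s * y))" if "c \<ge> 0" for s :: complex and c
    by (intro continuous_intros continuous_on_subset[OF cont]) (use that in auto)
  have "uniform_limit (cball x d) f (\<lambda>s. LINT y:{0..}|lborel. g y * exp (s * y)) sequentially"
  proof (rule uniform_limitI)
    fix e :: real assume "e > 0"
    have "(\<lambda>n. C * exp (- d * real n) / d) \<longlonglongrightarrow> 0"
      using d by real_asymp
    hence "\<forall>\<^sub>F n in sequentially. C * exp (- d * real n) / d < e"
      using \<open>e > 0\<close> by (rule order_tendstoD)
    thus "\<forall>\<^sub>F n in sequentially. \<forall>s\<in>cball x d. dist (f n s) (LINT y:{0..}|lborel. g y * exp (s * y)) < e"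
    proof eventually_elim
      case (elim n)
      show ?case
      proof
        fix s assume s: "s \<in> cball x d"
        let ?h = "\<lambda>y. g y * exp (s * complex_of_real y)"
        have i0: "set_integrable lborel {0..} ?h"
          by (rule set_lborel_dominated_exp_minus[OF d gc gb[OF s]]) auto
        have i1: "set_integrable lborel {0..<real n} ?h" "set_integrable lborel {0..real n} ?h"
          "set_integrable lborel {real n..} ?h"
          by (rule set_integrable_subset[OF i0]; auto)+
        have "(LINT y:{0..}|lborel. ?h y) = (LINT y:{0..real n} \<union> {real n..}|lborel. ?h y)"
          by (rule arg_cong[of _ _ "\<lambda>A. set_lebesgue_integral lborel A ?h"]) auto
        also have "\<dots> = (LINT y:{0..real n}|lborel. ?h y) + (LINT y:{real n..}|lborel. ?h y)"
          by (intro set_integral_Un_AE i1 AE_I[of _ _ "{real n}"]) auto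
        also have "(LINT y:{0..real n}|lborel. ?h y) = f n s"
          using set_borel_integral_eq_integral(2)[OF i1(2)] by (simp add: f_def)
        finally have "dist (f n s) (LINT y:{0..}|lborel. ?h y) = norm (LINT y:{real n..}|lborel. ?h y)"
          by (simp add: dist_norm norm_minus_commute)
        also have "\<dots> \<le> C * exp (- d * real n) / d"
          by (rule set_lborel_dominated_exp_minus[OF d gc gb[OF s]]) auto
        also have "\<dots> < e" by fact
        finally show "dist (f n s) (LINT y:{0..}|lborel. ?h y) < e" .
      qed
    qed
  qed
  moreover have "cball x d \<subseteq> {s. Re s < a}"
  proof
    fix s assume "s \<in> cball x d"
    from Re_le[OF this] d show "s \<in> {s. Re s < a}" by simp
  qed
  ultimately show "\<exists>d>0. cball x d \<subseteq> {s. Re s < a} \<and>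
      uniform_limit (cball x d) f (\<lambda>s. LINT y:{0..}|lborel. g y * exp (s * y)) sequentially"
    using d by (intro exI[of _ d] conjI)
qed

lemma set_lborel_exp_complex_at_least_0:
  fixes w :: complex
  assumes "Re w > 0"
  shows "set_integrable lborel {0..} (\<lambda>y. exp (- w * of_real y))"
    and "(LINT y:{0..}|lborel. exp (- w * of_real y)) = 1 / w"
proof -
  have b: "norm (exp (- w * of_real y)) \<le> 1 * exp (- Re w * y)" for y
    by simp
  show i: "set_integrable lborel {0..} (\<lambda>y. exp (- w * of_real y))"
    by (rule set_lborel_dominated_exp_minus[OF assms _ b]) (intro continuous_intros)
  have w: "w \<noteq> 0" using assms by auto
  have "(LBINT y=0..\<infinity>. exp (- w * of_real y)) = 0 - (- 1 / w)"
  proof (rule interval_integral_FTC_integrable)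
    show "((\<lambda>y. - exp (- w * of_real y) / w) has_vector_derivative exp (- w * of_real x)) (at x)" for x
      using w by (intro has_vector_derivative_real_field[where f = "\<lambda>y. - exp (- w * y) / w"])
        (auto intro!: derivative_eq_intros)
    show "set_integrable lborel (einterval 0 \<infinity>) (\<lambda>y. exp (- w * of_real y))"
      by (rule set_integrable_subset[OF i]) (auto simp: einterval_def zero_ereal_def)
    have "((\<lambda>y. exp (- w * of_real y)) \<longlongrightarrow> 0) at_top"
    proof (rule tendsto_norm_zero_cancel)
      have "((\<lambda>y. exp (- Re w * y)) \<longlongrightarrow> 0) at_top" using assms by real_asymp
      thus "((\<lambda>y. norm (exp (- w * of_real y))) \<longlongrightarrow> 0) at_top" by simp
    qed
    hence "((\<lambda>y. - exp (- w * of_real y) / w) \<longlongrightarrow> - 0 / w) at_top"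
      by (intro tendsto_intros w)
    thus "(((\<lambda>y. - exp (- w * of_real y) / w) \<circ> real_of_ereal) \<longlongrightarrow> 0) (at_left \<infinity>)"
      by (simp add: ereal_tendsto_simps)
    have "((\<lambda>y. - exp (- w * of_real y) / w) \<longlongrightarrow> - exp (- w * of_real 0) / w) (at_right 0)"
      by (intro tendsto_intros w)
    thus "(((\<lambda>y. - exp (- w * of_real y) / w) \<circ> real_of_ereal) \<longlongrightarrow> - 1 / w) (at_right 0)"
      by (simp add: zero_ereal_def ereal_tendsto_simps)
  qed (auto intro!: continuous_intros)
  moreover have "(LBINT y=0..\<infinity>. exp (- w * of_real y)) = (LINT y:{0<..}|lborel. exp (- w * of_real y))"
    by (simp add: interval_integral_Ioi)
  moreover have "\<dots> = (LINT y:{0..}|lborel. exp (- w * of_real y))"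
  proof (rule set_integral_cong_set)
    show "AE y in lborel. (y \<in> {0::real..}) = (y \<in> {0<..})"
      using AE_lborel_singleton[of 0] by eventually_elim auto
  qed (auto simp: set_borel_measurable_def)
  ultimately show "(LINT y:{0..}|lborel. exp (- w * of_real y)) = 1 / w" by simp
qed

section \<open>Euler's Gamma integral on the whole line\<close>

lemma power_over_fact_le_exp:
  fixes u :: real
  assumes "u \<ge> 0"
  shows "u ^ K / fact K \<le> exp u"
proof -
  have "(\<Sum>n\<in>{K}. u ^ n /\<^sub>R fact n) \<le> (\<Sum>n. u ^ n /\<^sub>R fact n)"
    using assms by (intro sum_le_suminf summable_exp_generic) auto
  thus ?thesis by (simp add: exp_def field_simps)
qed

text \<open>Trades double-exponential decay for decay at an arbitrary rate \<open>K\<close>. The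
  price \<open>fact K\<close> is what later determines the order of growth of xi.\<close>

lemma exp_minus_exp_le:
  fixes y :: real
  shows "exp (- exp y) \<le> fact K * exp (- real K * y)"
proof -
  have "exp y ^ K / fact K \<le> exp (exp y)" by (rule power_over_fact_le_exp) simp
  hence "exp (real K * y) \<le> fact K * exp (exp y)"
    unfolding exp_of_nat_mult by (simp add: field_simps)
  thus ?thesis by (simp add: exp_minus field_simps)
qed

lemma lborel_integral_split_reflect:
  fixes f :: "real \<Rightarrow> complex"
  assumes pos: "set_integrable lborel {0..} f" and neg: "set_integrable lborel {0..} (\<lambda>y. f (-y))"
  shows "integrable lborel f"
    and "(LINT y|lborel. f y) = (LINT y:{0..}|lborel. f y) + (LINT y:{0..}|lborel. f (-y))"
proof -
  have eq: "(\<lambda>y. indicator {0..} (0 + (-1) * y) *\<^sub>R f (- (0 + (-1) * y))) = (\<lambda>y. indicator {..0} y *\<^sub>R f y)"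
    by (auto simp: indicator_def)
  have neg': "set_integrable lborel {..0} f"
    using lborel_integrable_real_affine[OF neg[unfolded set_integrable_def], of "-1" 0]
    unfolding set_integrable_def eq by simp
  have neg_eq: "(LINT y:{0..}|lborel. f (-y)) = (LINT y:{..0}|lborel. f y)"
    using lborel_integral_real_affine[of "-1" "\<lambda>y. indicator {0..} y *\<^sub>R f (-y)" 0]
    unfolding set_lebesgue_integral_def eq by simp
  have U: "{0..} \<union> {..0} = (UNIV :: real set)" by auto
  have "set_integrable lborel ({0..} \<union> {..0}) f"
    by (intro set_integrable_Un pos neg') auto
  thus "integrable lborel f" unfolding U by (simp add: set_integrable_def)
  have "(LINT y:{0..} \<union> {..0}|lborel. f y) = (LINT y:{0..}|lborel. f y) + (LINT y:{..0}|lborel. f y)"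
  proof (rule set_integral_Un_AE[OF _ _ _ pos neg'])
    show "AE y in lborel. \<not> (y \<in> {0::real..} \<and> y \<in> {..0})"
      using AE_lborel_singleton[of 0] by eventually_elim auto
  qed auto
  thus "(LINT y|lborel. f y) = (LINT y:{0..}|lborel. f y) + (LINT y:{0..}|lborel. f (-y))"
    unfolding U neg_eq by (simp add: set_lebesgue_integral_def)
qed

text \<open>The substitution \<open>t = exp y\<close> in Euler's integral. In this form a change of
  scale in \<open>t\<close> becomes a translation in \<open>y\<close>.\<close>

lemma Gamma_integral_exp:
  fixes z :: complex
  assumes z: "Re z > 0"
  shows "integrable lborel (\<lambda>y. exp (z * of_real y - of_real (exp y)))" (is "integrable _ ?G")
    and "(LINT y|lborel. exp (z * of_real y - of_real (exp y))) = Gamma z"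
proof -
  \<comment> \<open>Large enough that the decay at rate \<open>K\<close> beats the factor
    \<open>exp (Re z * y)\<close> and leaves \<open>exp (- y)\<close>.\<close>
  define K where "K = nat \<lceil>Re z\<rceil> + 1"
  have K: "real K \<ge> Re z + 1" unfolding K_def by linarith
  have cont: "continuous_on A ?G" for A by (intro continuous_intros)
  have pos: "set_integrable lborel {0..} ?G"
  proof (rule set_lborel_dominated_exp_minus[where k = 1 and C = "fact K"])
    fix y :: real assume y: "y \<ge> 0"
    have "norm (?G y) = exp (Re z * y) * exp (- exp y)" by (simp add: mult_exp_exp)
    also have "\<dots> \<le> exp (Re z * y) * (fact K * exp (- real K * y))"
      by (intro mult_left_mono exp_minus_exp_le) auto
    also have "\<dots> = fact K * exp ((Re z - real K) * y)" by (simp add: mult_exp_exp algebra_simps)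
    also have "\<dots> \<le> fact K * exp (- 1 * y)"
      using K y by (intro mult_left_mono exp_le_cancel_iff[THEN iffD2] mult_right_mono) auto
    finally show "norm (?G y) \<le> fact K * exp (- 1 * y)" .
  qed (use cont in auto)
  have neg: "set_integrable lborel {0..} (\<lambda>y. ?G (-y))"
  proof (rule set_lborel_dominated_exp_minus[where k = "Re z" and C = 1])
    fix y :: real assume y: "y \<ge> 0"
    show "norm (?G (-y)) \<le> 1 * exp (- Re z * y)" by simp
  qed (use z in \<open>auto intro!: continuous_intros\<close>)
  show int: "integrable lborel ?G" by (rule lborel_integral_split_reflect[OF pos neg])
  let ?f = "\<lambda>t. of_real t powr (z - 1) / of_real (exp t) :: complex"
  have f_eq: "exp x *\<^sub>R ?f (exp x) = ?G x" for x :: real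
  proof -
    have "of_real (exp x) powr (z - 1) = exp (of_real x * (z - 1))"
      by (simp add: powr_def exp_of_real[symmetric] Ln_of_real mult.commute)
    thus ?thesis by (simp add: scaleR_conv_of_real exp_of_real[symmetric] exp_diff right_diff_distrib mult.commute)
  qed
  have int_f: "set_integrable lborel {0<..} ?f"
  proof -
    have "set_integrable lebesgue {0<..} ?f" by (rule absolutely_integrable_Gamma_integral'[OF z])
    moreover have "(\<lambda>t. indicator {0<..} t *\<^sub>R ?f t) \<in> borel_measurable lborel"
      using borel_measurable_continuous_on_indicator[of "{0<..}" ?f]
      by (auto intro!: continuous_intros)
    ultimately show ?thesis unfolding set_integrable_def by (subst (asm) integrable_completion) auto
  qed
  have "(LBINT x=0..\<infinity>. ?f x) = (LBINT x=-\<infinity>..\<infinity>. exp x *\<^sub>R ?f (exp x))"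
  proof (rule interval_integral_substitution_integrable)
    show "isCont ?f (exp x)" for x
      by (intro continuous_intros) auto
    have "((\<lambda>x. ereal (exp x)) \<longlongrightarrow> 0) at_bot"
      unfolding zero_ereal_def lim_ereal by (rule exp_at_bot)
    thus "((ereal \<circ> exp \<circ> real_of_ereal) \<longlongrightarrow> 0) (at_right (-\<infinity>))"
      by (simp add: ereal_tendsto_simps comp_def[of ereal exp])
    have "((\<lambda>x. ereal (exp x)) \<longlongrightarrow> \<infinity>) at_top"
      using exp_at_top by (simp add: tendsto_PInfty_eq_at_top)
    thus "((ereal \<circ> exp \<circ> real_of_ereal) \<longlongrightarrow> \<infinity>) (at_left \<infinity>)"
      by (simp add: ereal_tendsto_simps comp_def[of ereal exp])
    have "einterval 0 \<infinity> = {0<..}" by (auto simp: einterval_def)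
    thus "set_integrable lborel (einterval 0 \<infinity>) ?f" using int_f by simp
    show "set_integrable lborel (einterval (-\<infinity>) \<infinity>) (\<lambda>x. exp x *\<^sub>R ?f (exp x))"
      unfolding f_eq using int by (simp add: set_integrable_def)
  qed (auto intro!: derivative_eq_intros)
  also have "(LBINT x=-\<infinity>..\<infinity>. exp x *\<^sub>R ?f (exp x)) = (LINT y|lborel. ?G y)"
    unfolding f_eq by (simp add: interval_lebesgue_integral_def set_lebesgue_integral_def)
  also have "(LBINT x=0..\<infinity>. ?f x) = (LINT t:{0<..}|lborel. ?f t)"
    by (simp add: interval_integral_Ioi)
  also have "\<dots> = integral {0<..} ?f"
    by (rule set_borel_integral_eq_integral[OF int_f])
  also have "\<dots> = Gamma z" using Gamma_integral_complex'[OF z] by (rule integral_unique)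
  finally show "(LINT y|lborel. ?G y) = Gamma z" ..
qed

section \<open>The Mellin transform of the theta series and the zeta function\<close>

text \<open>Riemann's function psi, half of Jacobi's theta minus 1, at the point
  \<open>exp y\<close>. The logarithmic variable turns the inversion of the argument into the
  reflection \<open>y\<close> to \<open>-y\<close>.\<close>

definition theta_tail :: "real \<Rightarrow> real" where
  "theta_tail y = (\<Sum>n. exp (- (pi * (real (Suc n))\<^sup>2 * exp y)))"

text \<open>For \<open>N, E \<ge> 1\<close> one has
  \<open>E + N \<le> 2 * N * E \<le> pi * N^2 * E\<close>. The bound separates the variables: one
  factor decays in \<open>y\<close>, the other is summable in \<open>n\<close>.\<close>

lemma theta_tail_term_le:
  assumes "y \<ge> 0"
  shows "exp (- (pi * (real (Suc n))\<^sup>2 * exp y)) \<le> exp (- exp y) * exp (- 1 * real (Suc n))"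
proof -
  define N E where "N = real (Suc n)" and "E = exp y"
  have N: "N \<ge> 1" and E: "E \<ge> 1" using assms by (auto simp: N_def E_def)
  have "E + N \<le> N * E + N * E"
    using mult_right_mono[of 1 N E] mult_left_mono[of 1 E N] N E by linarith
  also have "\<dots> = 2 * N * E" by simp
  also have "\<dots> \<le> pi * N\<^sup>2 * E"
  proof -
    have "2 * N \<le> pi * N\<^sup>2"
      using N pi_ge_two by (intro mult_mono) (auto simp: power2_eq_square)
    thus ?thesis using E by (intro mult_right_mono) auto
  qed
  finally show ?thesis unfolding mult_exp_exp N_def[symmetric] E_def[symmetric] by simp
qed

lemma summable_theta_tail: "summable (\<lambda>n. exp (- (pi * (real (Suc n))\<^sup>2 * exp y)))"
proof (rule summable_comparison_test)
  show "\<exists>N. \<forall>n\<ge>N. norm (exp (- (pi * (real (Suc n))\<^sup>2 * exp y))) \<le> exp (- (pi * exp y) * real (Suc n))"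
  proof (intro exI allI impI)
    fix n
    have "real (Suc n) \<le> (real (Suc n))\<^sup>2" by (simp add: power2_eq_square)
    hence "(pi * exp y) * real (Suc n) \<le> (pi * exp y) * (real (Suc n))\<^sup>2"
      by (intro mult_left_mono) auto
    thus "norm (exp (- (pi * (real (Suc n))\<^sup>2 * exp y))) \<le> exp (- (pi * exp y) * real (Suc n))"
      by (simp add: mult_ac)
  qed
qed (intro summable_exp_times_Suc, simp)

lemma theta_tail_nonneg: "theta_tail y \<ge> 0"
  unfolding theta_tail_def by (intro suminf_nonneg summable_theta_tail) auto

lemma continuous_on_theta_tail: "continuous_on {0..} theta_tail"
proof -
  have "uniform_limit {0..} (\<lambda>n y. \<Sum>i<n. exp (- (pi * (real (Suc i))\<^sup>2 * exp y)))
          (\<lambda>y. \<Sum>i. exp (- (pi * (real (Suc i))\<^sup>2 * exp y))) sequentially"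
  proof (rule Weierstrass_m_test)
    fix n and y :: real assume "y \<in> {0..}"
    hence "exp (- (pi * (real (Suc n))\<^sup>2 * exp y)) \<le> exp (- exp y) * exp (- 1 * real (Suc n))"
      by (intro theta_tail_term_le) auto
    also have "\<dots> \<le> 1 * exp (- 1 * real (Suc n))" by (intro mult_right_mono) auto
    finally show "norm (exp (- (pi * (real (Suc n))\<^sup>2 * exp y))) \<le> exp (- 1 * real (Suc n))" by simp
  qed (rule summable_exp_times_Suc, simp)
  hence "continuous_on {0..} (\<lambda>y. \<Sum>i. exp (- (pi * (real (Suc i))\<^sup>2 * exp y)))"
    by (rule uniform_limit_theorem[rotated]) (auto intro!: always_eventually continuous_intros)
  thus ?thesis unfolding theta_tail_def .
qed

definition theta_tail_const :: real where
  "theta_tail_const = (\<Sum>n. exp (- 1 * real (Suc n)))"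

lemma theta_tail_le:
  assumes "y \<ge> 0"
  shows "theta_tail y \<le> theta_tail_const * (fact K * exp (- real K * y))"
proof -
  have s: "summable (\<lambda>n. exp (- 1 * real (Suc n)))" by (rule summable_exp_times_Suc) simp
  have "theta_tail y \<le> (\<Sum>n. exp (- exp y) * exp (- 1 * real (Suc n)))"
    unfolding theta_tail_def using assms
    by (intro suminf_le summable_theta_tail theta_tail_term_le summable_mult s)
  also have "\<dots> = exp (- exp y) * theta_tail_const"
    unfolding theta_tail_const_def by (rule suminf_mult[OF s])
  also have "\<dots> \<le> (fact K * exp (- real K * y)) * theta_tail_const"
    unfolding theta_tail_const_def by (intro mult_right_mono exp_minus_exp_le suminf_nonneg s) auto
  finally show ?thesis by (simp add: mult.commute)
qed

text \<open>\<open>theta_reciprocity\<close> at \<open>x = pi * exp y\<close>.\<close>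

lemma theta_tail_minus: "1 + 2 * theta_tail (- y) = exp (y / 2) * (1 + 2 * theta_tail y)"
proof -
  have "1 + 2 * (\<Sum>n. exp (- pi\<^sup>2 * (real (Suc n))\<^sup>2 / (pi * exp y))) =
         sqrt (pi * exp y / pi) * (1 + 2 * (\<Sum>n. exp (- (pi * exp y) * (real (Suc n))\<^sup>2)))"
    by (rule theta_reciprocity) simp
  also have "sqrt (pi * exp y / pi) = exp (y / 2)"
    by (simp add: real_sqrt_unique power2_eq_square mult_exp_exp)
  also have "(\<Sum>n. exp (- (pi * exp y) * (real (Suc n))\<^sup>2)) = theta_tail y"
    unfolding theta_tail_def by (intro suminf_cong) (simp add: mult_ac)
  also have "(\<Sum>n. exp (- pi\<^sup>2 * (real (Suc n))\<^sup>2 / (pi * exp y))) = theta_tail (- y)"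
  proof -
    have "- pi\<^sup>2 * a / (pi * exp y) = - (pi * a * exp (- y))" for a
      by (simp add: exp_minus power2_eq_square field_simps)
    thus ?thesis unfolding theta_tail_def by simp
  qed
  finally show ?thesis .
qed

text \<open>The part of the Mellin transform of psi over the arguments at least 1, after the
  substitution by \<open>exp y\<close>. On that side psi decays faster than any power, so the
  integral converges for every \<open>z\<close>.\<close>

definition theta_mellin :: "complex \<Rightarrow> complex" where
  "theta_mellin z = (LINT y:{0..}|lborel. of_real (theta_tail y) * exp (z * of_real y))"

lemma theta_tail_complex_bound:
  assumes "y \<ge> 0"
  shows "norm (complex_of_real (theta_tail y)) \<le> theta_tail_const * fact K * exp (- real K * y)"
  using theta_tail_le[OF assms, of K] theta_tail_nonneg[of y] by (simp add: mult.assoc)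

lemma continuous_on_theta_tail_exp:
  "continuous_on {0..} (\<lambda>y. complex_of_real (theta_tail y) * exp (z * of_real y))"
  by (intro continuous_intros continuous_on_theta_tail)

lemma theta_mellin_integrand_le:
  assumes "Re z + 1 \<le> real K" "y \<ge> 0"
  shows "norm (complex_of_real (theta_tail y) * exp (z * of_real y)) \<le> theta_tail_const * fact K * exp (- 1 * y)"
proof -
  have C: "theta_tail_const \<ge> 0" unfolding theta_tail_const_def
    by (intro suminf_nonneg summable_exp_times_Suc) auto
  have "norm (complex_of_real (theta_tail y) * exp (z * of_real y)) \<le>
     (theta_tail_const * fact K * exp (- real K * y)) * exp (Re z * y)"
    unfolding norm_mult using theta_tail_complex_bound[OF assms(2), of K]
    by (intro mult_mono) auto
  also have "\<dots> = theta_tail_const * fact K * exp ((Re z - real K) * y)"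
    by (simp add: mult_exp_exp algebra_simps)
  also have "\<dots> \<le> theta_tail_const * fact K * exp (- 1 * y)"
    using assms C by (intro mult_left_mono exp_le_cancel_iff[THEN iffD2] mult_right_mono) auto
  finally show ?thesis .
qed

lemma set_integrable_theta_mellin:
  "set_integrable lborel {0..} (\<lambda>y. complex_of_real (theta_tail y) * exp (z * of_real y))"
proof -
  have "Re z + 1 \<le> real (nat \<lceil>Re z\<rceil> + 1)" by linarith
  from theta_mellin_integrand_le[OF this] show ?thesis
    by (intro set_lborel_dominated_exp_minus[where k = 1] continuous_on_theta_tail_exp) auto
qed

text \<open>Only \<open>Re z\<close> matters, and the bound grows like its factorial.\<close>

lemma norm_theta_mellin_le:
  assumes "Re z + 1 \<le> real K"
  shows "norm (theta_mellin z) \<le> theta_tail_const * fact K"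
  unfolding theta_mellin_def
  using set_lborel_dominated_exp_minus(2)[OF _ continuous_on_theta_tail_exp theta_mellin_integrand_le[OF assms]]
  by simp

lemma theta_mellin_holomorphic: "theta_mellin holomorphic_on UNIV"
proof -
  have "theta_mellin field_differentiable at z" for z
  proof -
    define K where "K = nat \<lceil>Re z\<rceil> + 1"
    have K: "real K > Re z" unfolding K_def by linarith
    have "theta_mellin holomorphic_on {s. Re s < real K}"
      unfolding theta_mellin_def
      by (rule holomorphic_on_half_line_transform[OF _ theta_tail_complex_bound])
         (intro continuous_intros continuous_on_theta_tail)
    thus ?thesis using K
      by (auto intro: holomorphic_on_imp_differentiable_at open_halfspace_Re_lt)
  qed
  thus ?thesis by (simp add: holomorphic_on_def field_differentiable_at_within)
qed

text \<open>Riemann's splitting at \<open>y = 0\<close>. On the negative side the reciprocity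
  replaces \<open>theta_tail (- y)\<close> by
  \<open>exp (y / 2) * theta_tail y + (exp (y / 2) - 1) / 2\<close>; the two elementary exponentials
  integrate to \<open>1 / (s - 1)\<close> and \<open>1 / s\<close>, and the rest is the transform at
  the reflected point.\<close>

lemma theta_full_mellin:
  assumes s: "Re s > 1"
  shows "integrable lborel (\<lambda>y. complex_of_real (theta_tail y) * exp (s / 2 * of_real y))"
    and "(LINT y|lborel. complex_of_real (theta_tail y) * exp (s / 2 * of_real y)) =
           1 / (s - 1) - 1 / s + theta_mellin (s / 2) + theta_mellin ((1 - s) / 2)"
proof -
  let ?f = "\<lambda>y. complex_of_real (theta_tail y) * exp (s / 2 * of_real y)"
  have pos: "set_integrable lborel {0..} ?f" by (rule set_integrable_theta_mellin)
  have f_minus: "?f (- y) = 1/2 * exp (- ((s - 1) / 2) * of_real y) - 1/2 * exp (- (s / 2) * of_real y) +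
     complex_of_real (theta_tail y) * exp ((1 - s) / 2 * of_real y)" for y
  proof -
    have "complex_of_real (1 + 2 * theta_tail (- y)) = of_real (exp (y / 2) * (1 + 2 * theta_tail y))"
      by (simp only: theta_tail_minus)
    hence eq: "complex_of_real (theta_tail (- y)) = (exp (of_real y / 2) * (1 + 2 * of_real (theta_tail y)) - 1) / 2"
      by (simp add: field_simps flip: exp_of_real)
    have "?f (- y) = 1/2 * (exp (of_real y / 2) * exp (s / 2 * of_real (- y))) - 1/2 * exp (s / 2 * of_real (- y)) +
        of_real (theta_tail y) * (exp (of_real y / 2) * exp (s / 2 * of_real (- y)))"
      unfolding eq by (simp add: algebra_simps add_divide_distrib diff_divide_distrib)
    note main = this
    have AB: "exp (of_real y / 2) * exp (s / 2 * of_real (- y)) = exp (- ((s - 1) / 2) * complex_of_real y)"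
      unfolding mult_exp_exp by (rule arg_cong[of _ _ exp]) (simp add: field_simps)
    have C: "exp ((1 - s) / 2 * of_real y) = exp (- ((s - 1) / 2) * complex_of_real y)"
      by (rule arg_cong[of _ _ exp]) (simp add: field_simps)
    have B: "exp (s / 2 * of_real (- y)) = exp (- (s / 2) * complex_of_real y)" by simp
    show ?thesis unfolding C main[unfolded AB] unfolding B ..
  qed
  have w1: "Re ((s - 1) / 2) > 0" and w2: "Re (s / 2) > 0" using s by auto
  have i1: "set_integrable lborel {0..} (\<lambda>y. 1/2 * exp (- ((s - 1) / 2) * of_real y))"
    using set_lborel_exp_complex_at_least_0(1)[OF w1] by (intro set_integrable_mult_right) auto
  have i2: "set_integrable lborel {0..} (\<lambda>y. 1/2 * exp (- (s / 2) * of_real y))"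
    using set_lborel_exp_complex_at_least_0(1)[OF w2] by (intro set_integrable_mult_right) auto
  note i3 = set_integrable_theta_mellin[of "(1 - s) / 2"]
  have neg: "set_integrable lborel {0..} (\<lambda>y. ?f (-y))"
    unfolding f_minus by (intro set_integral_add set_integral_diff i1 i2 i3)
  show "integrable lborel ?f" by (rule lborel_integral_split_reflect[OF pos neg])
  have "(LINT y|lborel. ?f y) = theta_mellin (s / 2) + (LINT y:{0..}|lborel. ?f (-y))"
    unfolding theta_mellin_def by (rule lborel_integral_split_reflect[OF pos neg])
  also have "(LINT y:{0..}|lborel. ?f (-y)) =
     (LINT y:{0..}|lborel. 1/2 * exp (- ((s - 1) / 2) * of_real y)) -
     (LINT y:{0..}|lborel. 1/2 * exp (- (s / 2) * of_real y)) + theta_mellin ((1 - s) / 2)"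
    unfolding f_minus theta_mellin_def
    by (subst set_integral_add(2)[OF set_integral_diff(1)[OF i1 i2] i3], subst set_integral_diff(2)[OF i1 i2]) simp
  also have "(LINT y:{0..}|lborel. 1/2 * exp (- ((s - 1) / 2) * of_real y)) = 1 / (s - 1)"
    by (simp only: set_integral_mult_right set_lborel_exp_complex_at_least_0(2)[OF w1]) simp
  also have "(LINT y:{0..}|lborel. 1/2 * exp (- (s / 2) * of_real y)) = 1 / s"
    by (simp only: set_integral_mult_right set_lborel_exp_complex_at_least_0(2)[OF w2]) simp
  finally show "(LINT y|lborel. ?f y) = 1 / (s - 1) - 1 / s + theta_mellin (s / 2) + theta_mellin ((1 - s) / 2)"
    by simp
qed

text \<open>Termwise integration of the theta series: each term is a translate of the Gamma
  integrand and produces one term of the Dirichlet series. The interchange is justified by the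
  convergence of the series with exponent \<open>Re s > 1\<close>. Multiplying by
  \<open>rGamma\<close> removes the Gamma factor again.\<close>

lemma theta_full_mellin_sums:
  assumes s: "Re s > 1"
  shows "(\<lambda>n. 1 / of_nat (Suc n) powr s) sums
           (of_real pi powr (s / 2) * rGamma (s / 2) *
            (LINT y|lborel. complex_of_real (theta_tail y) * exp (s / 2 * of_real y)))"
proof -
  \<comment> \<open>Chosen so that \<open>exp (t n + y)\<close> is the exponent in the
    \<open>n\<close>-th theta term, which makes that term a translate of \<open>G\<close> by
    \<open>t n\<close>.\<close>
  define t where "t = (\<lambda>n. ln (pi * (real (Suc n))\<^sup>2))"
  define G where "G = (\<lambda>y. exp (s / 2 * of_real y - complex_of_real (exp y)))"
  define f where "f = (\<lambda>n y. exp (- (s / 2) * complex_of_real (t n)) * G (t n + 1 * y))"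
  have s2: "Re (s / 2) > 0" using s by simp
  have iG: "integrable lborel G" unfolding G_def by (rule Gamma_integral_exp[OF s2])
  have LG: "(LINT y|lborel. G y) = Gamma (s / 2)" unfolding G_def by (rule Gamma_integral_exp[OF s2])
  have f_eq: "f n y = exp (s / 2 * of_real y) * complex_of_real (exp (- (pi * (real (Suc n))\<^sup>2 * exp y)))" for n y
  proof -
    have "exp (t n + y) = pi * (real (Suc n))\<^sup>2 * exp y"
      by (simp add: exp_add t_def)
    hence "f n y = exp (- (s / 2) * of_real (t n)) * exp (s / 2 * of_real (t n + y) - of_real (pi * (real (Suc n))\<^sup>2 * exp y))"
      by (simp add: f_def G_def)
    also have "\<dots> = exp (s / 2 * of_real y + of_real (- (pi * (real (Suc n))\<^sup>2 * exp y)))"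
      unfolding mult_exp_exp by (rule arg_cong[of _ _ exp]) (simp add: algebra_simps)
    also have "\<dots> = exp (s / 2 * of_real y) * complex_of_real (exp (- (pi * (real (Suc n))\<^sup>2 * exp y)))"
      by (simp only: exp_add exp_of_real)
    finally show ?thesis .
  qed
  have if': "integrable lborel (f n)" for n
    unfolding f_def by (intro integrable_mult_right lborel_integrable_real_affine iG) auto
  have Lf: "(LINT y|lborel. f n y) = exp (- (s / 2) * of_real (t n)) * Gamma (s / 2)" for n
    using lborel_integral_real_affine[of 1 G "t n"] by (simp add: f_def LG)
  have norm_Lf: "(LINT y|lborel. norm (f n y)) = exp (- (Re s / 2) * t n) * (LINT y|lborel. norm (G y))" for n
    using lborel_integral_real_affine[of 1 "\<lambda>y. norm (G y)" "t n"] by (simp add: f_def norm_mult)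
  have exp_t: "exp (- (s / 2) * of_real (t n)) = of_real pi powr (- (s / 2)) * (1 / of_nat (Suc n) powr s)" for n
  proof -
    have tn: "t n = ln pi + 2 * ln (real (Suc n))"
      by (simp add: t_def ln_mult ln_realpow)
    have "exp (- (s / 2) * of_real (t n)) = exp (- (s / 2) * of_real (ln pi)) * exp (- (s * of_real (ln (real (Suc n)))))"
      unfolding tn mult_exp_exp by (rule arg_cong[of _ _ exp]) (simp add: algebra_simps)
    also have "exp (- (s / 2) * of_real (ln pi)) = of_real pi powr (- (s / 2))"
      by (simp add: powr_def Ln_of_real)
    also have "exp (- (s * of_real (ln (real (Suc n))))) = 1 / of_nat (Suc n) powr s"
      using Ln_of_real[of "real (Suc n)"] by (simp add: powr_def exp_minus inverse_eq_divide del: of_nat_Suc)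
    finally show ?thesis .
  qed
  have summ: "summable (\<lambda>n. LINT y|lborel. norm (f n y))"
  proof -
    have "exp (- (Re s / 2) * t n) = exp (- (Re s / 2) * ln pi) * real (Suc n) powr (- Re s)" for n
    proof -
      have tn: "t n = ln pi + 2 * ln (real (Suc n))"
        by (simp add: t_def ln_mult ln_realpow)
      show ?thesis unfolding tn powr_def by (simp add: mult_exp_exp algebra_simps)
    qed
    moreover have "summable (\<lambda>n. real (Suc n) powr (- Re s))"
      using s by (subst summable_Suc_iff) (simp add: summable_real_powr_iff)
    ultimately show ?thesis unfolding norm_Lf by (intro summable_mult2) (simp add: summable_mult)
  qed
  have AE: "AE y in lborel. summable (\<lambda>n. norm (f n y))"
    unfolding f_eq norm_mult norm_of_real abs_exp_cancel
    by (intro AE_I2 summable_mult summable_theta_tail)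
  have "(\<lambda>n. LINT y|lborel. f n y) sums (LINT y|lborel. (\<Sum>n. f n y))"
    by (rule sums_integral[OF if' AE summ])
  also have "(\<lambda>y. \<Sum>n. f n y) = (\<lambda>y. complex_of_real (theta_tail y) * exp (s / 2 * of_real y))"
  proof
    fix y
    have "(\<lambda>n. complex_of_real (exp (- (pi * (real (Suc n))\<^sup>2 * exp y)))) sums of_real (theta_tail y)"
      unfolding theta_tail_def by (intro sums_of_real summable_sums summable_theta_tail)
    hence "(\<lambda>n. f n y) sums (exp (s / 2 * of_real y) * of_real (theta_tail y))"
      unfolding f_eq by (rule sums_mult)
    thus "(\<Sum>n. f n y) = of_real (theta_tail y) * exp (s / 2 * of_real y)"
      by (subst mult.commute) (rule sums_unique[symmetric])
  qed
  finally have "(\<lambda>n. of_real pi powr (- (s / 2)) * (1 / of_nat (Suc n) powr s) * Gamma (s / 2)) sums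
      (LINT y|lborel. complex_of_real (theta_tail y) * exp (s / 2 * of_real y))"
    unfolding Lf exp_t .
  from sums_mult[OF this, of "of_real pi powr (s / 2) * rGamma (s / 2)"]
  show ?thesis
  proof (rule sums_cong[THEN iffD1, rotated])
    fix n
    have "s / 2 \<notin> \<int>\<^sub>\<le>\<^sub>0" using s2 by (auto elim!: nonpos_Ints_cases)
    hence "Gamma (s / 2) * rGamma (s / 2) = 1" by (simp add: rGamma_inverse_Gamma Gamma_eq_zero_iff)
    moreover have "of_real pi powr (s / 2) * of_real pi powr (- (s / 2)) = (1 :: complex)"
      by (simp add: powr_def flip: exp_add)
    moreover have "(p * r) * (p' * x * g) = x" if "g * r = 1" "p * p' = 1" for p r p' x g :: complex
    proof -
      have "(p * r) * (p' * x * g) = (g * r) * (p * p') * x" by (simp only: mult_ac)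
      thus ?thesis using that by simp
    qed
    ultimately show "(of_real pi powr (s / 2) * rGamma (s / 2)) * (of_real pi powr (- (s / 2)) * (1 / of_nat (Suc n) powr s) * Gamma (s / 2)) = 1 / of_nat (Suc n) powr s"
      by blast
  qed
qed

section \<open>The xi function and the continuation of zeta\<close>

definition completed_part :: "complex \<Rightarrow> complex" where
  "completed_part s = theta_mellin (s / 2) + theta_mellin ((1 - s) / 2)"

text \<open>Twice the classical xi: it is \<open>s * (s - 1)\<close> times the completed zeta
  function, and the polar terms \<open>1 / (s - 1) - 1 / s\<close> become the summand 1. The
  normalization gives the value 1 at 0, as wanted for counting zeros.\<close>

definition riemann_xi :: "complex \<Rightarrow> complex" where
  "riemann_xi s = 1 + s * (s - 1) * completed_part s"

lemma completed_part_reflect: "completed_part (1 - s) = completed_part s"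
  by (simp add: completed_part_def add.commute)

lemma riemann_xi_reflect: "riemann_xi (1 - s) = riemann_xi s"
  unfolding riemann_xi_def completed_part_reflect by (simp add: algebra_simps)

lemma riemann_xi_0: "riemann_xi 0 = 1"
  by (simp add: riemann_xi_def)

lemma holomorphic_completed_part: "completed_part holomorphic_on A"
proof -
  have "theta_mellin \<circ> (\<lambda>s. s / 2) holomorphic_on A" "theta_mellin \<circ> (\<lambda>s. (1 - s) / 2) holomorphic_on A"
    by (rule holomorphic_on_compose_gen[OF _ theta_mellin_holomorphic]; auto intro!: holomorphic_intros)+
  thus ?thesis unfolding completed_part_def comp_def by (intro holomorphic_intros)
qed

lemma holomorphic_riemann_xi: "riemann_xi holomorphic_on A"
  unfolding riemann_xi_def by (intro holomorphic_intros holomorphic_completed_part)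

text \<open>Solving the completed function for zeta leaves
  \<open>rGamma (s / 2) / (s * (s - 1))\<close>, with an apparent pole at 0. Absorbing the factor
  \<open>1 / s\<close> into \<open>rGamma (s / 2 + 1)\<close> makes holomorphy at 0 visible. The
  value at 1 is that fixed for \<open>zeta\<close>.\<close>

definition zeta_formula :: "complex \<Rightarrow> complex" where
  "zeta_formula s = (if s = 1 then 0 else of_real pi powr (s / 2) *
     (rGamma (s / 2 + 1) / (2 * (s - 1)) + rGamma (s / 2) * completed_part s))"

lemma holomorphic_zeta_formula: "zeta_formula holomorphic_on - {1}"
proof -
  have "(\<lambda>s. of_real pi powr (s / 2) *
     (rGamma (s / 2 + 1) / (2 * (s - 1)) + rGamma (s / 2) * completed_part s)) holomorphic_on - {1}"
    by (intro holomorphic_intros holomorphic_completed_part holomorphic_rGamma') auto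
  thus ?thesis by (rule holomorphic_transform) (auto simp: zeta_formula_def)
qed

lemma zeta_formula_xi:
  assumes "s \<noteq> 0" "s \<noteq> 1"
  shows "zeta_formula s = of_real pi powr (s / 2) * rGamma (s / 2) / (s * (s - 1)) * riemann_xi s"
proof -
  have "s / 2 * rGamma (s / 2 + 1) = rGamma (s / 2)" by (rule rGamma_plus1)
  hence r: "rGamma (s / 2 + 1) = 2 * rGamma (s / 2) / s" using assms by (simp add: field_simps)
  show ?thesis using assms unfolding zeta_formula_def riemann_xi_def r by (simp add: field_simps)
qed

lemma zeta_formula_sums:
  assumes "Re s > 1"
  shows "(\<lambda>n. 1 / of_nat (Suc n) powr s) sums zeta_formula s"
proof -
  have ne: "s \<noteq> 0" "s \<noteq> 1" using assms by auto
  have "1 / (s - 1) - 1 / s + completed_part s = riemann_xi s / (s * (s - 1))"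
    using ne by (simp add: riemann_xi_def field_simps)
  hence L: "(LINT y|lborel. complex_of_real (theta_tail y) * exp (s / 2 * of_real y)) = riemann_xi s / (s * (s - 1))"
    unfolding theta_full_mellin(2)[OF assms] completed_part_def by (simp only: add.assoc)
  show ?thesis
    using theta_full_mellin_sums[OF assms] unfolding L zeta_formula_xi[OF ne] by simp
qed

text \<open>The description denotes something only once existence and uniqueness are known.
  Existence is the formula; uniqueness is the identity theorem on the punctured plane, which is
  connected.\<close>

theorem zeta_eq_formula: "zeta = zeta_formula"
  unfolding zeta_def
proof (rule the_equality)
  show "zeta_formula holomorphic_on (- {1}) \<and>
     (\<forall>s. 1 < Re s \<longrightarrow> (\<lambda>n. 1 / of_nat (Suc n) powr s) sums zeta_formula s) \<and> zeta_formula 1 = 0"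
    using holomorphic_zeta_formula zeta_formula_sums by (simp add: zeta_formula_def)
next
  fix f :: "complex \<Rightarrow> complex"
  assume f: "f holomorphic_on (- {1}) \<and> (\<forall>s. 1 < Re s \<longrightarrow> (\<lambda>n. 1 / of_nat (Suc n) powr s) sums f s) \<and> f 1 = 0"
  have eq: "f s - zeta_formula s = 0" if "Re s > 1" for s
    using f zeta_formula_sums[OF that] that by (auto dest: sums_unique2)
  show "f = zeta_formula"
  proof
    fix s
    show "f s = zeta_formula s"
    proof (cases "s = 1")
      case False
      have "f s - zeta_formula s = 0"
      proof (rule analytic_continuation_open[of "{s. Re s > 1}" "- {1}" "\<lambda>s. f s - zeta_formula s" "\<lambda>_. 0"])
        show "open {s. 1 < Re s}" by (rule open_halfspace_Re_gt)
        show "{s. 1 < Re s} \<noteq> {}" by (auto intro: exI[of _ 2])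
        show "connected (- {1 :: complex})" by (rule connected_punctured_universe) simp
        show "(\<lambda>s. f s - zeta_formula s) holomorphic_on - {1}"
          using f by (intro holomorphic_intros holomorphic_zeta_formula) auto
      qed (use eq False in auto)
      thus ?thesis by simp
    qed (use f in \<open>simp add: zeta_formula_def\<close>)
  qed
qed

section \<open>Counting zeros\<close>

text \<open>The quotient by the power of \<open>z - b\<close> is holomorphic away from
  \<open>b\<close>, and near \<open>b\<close> it agrees with the local factor
  \<open>zor_poly f b\<close>; the two are glued. The point \<open>w\<close> rules out the zero
  function, for which no order exists.\<close>

lemma holomorphic_factor_out_zero:
  assumes f: "f holomorphic_on UNIV" and nz: "f w \<noteq> 0"
  obtains g where "g holomorphic_on UNIV" "\<And>z. f z = g z * (z - b) ^ nat (zorder f b)"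
proof -
  define n h where "n = nat (zorder f b)" and "h = zor_poly f b"
  obtain r where r: "r > 0" "h holomorphic_on cball b r" "\<And>w. w \<in> cball b r \<Longrightarrow> f w = h w * (w - b) ^ n"
    using zorder_exist_zero[OF f open_UNIV connected_UNIV UNIV_I, of b] nz unfolding n_def h_def by blast
  define g where "g = (\<lambda>z. if z = b then h b else f z / (z - b) ^ n)"
  have g_ball: "g z = h z" if "z \<in> ball b r" for z
    using r(3)[of z] that by (auto simp: g_def)
  have "h holomorphic_on ball b r" by (rule holomorphic_on_subset[OF r(2)]) auto
  hence "g holomorphic_on ball b r" by (rule holomorphic_transform) (auto simp: g_ball)
  moreover have "(\<lambda>z. f z / (z - b) ^ n) holomorphic_on - {b}"
    by (intro holomorphic_intros holomorphic_on_subset[OF f]) auto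
  hence "g holomorphic_on - {b}" by (rule holomorphic_transform) (auto simp: g_def)
  ultimately have "g holomorphic_on ball b r \<union> - {b}" by (rule holomorphic_on_Un) auto
  also have "ball b r \<union> - {b} = UNIV" using r(1) by auto
  finally have "g holomorphic_on UNIV" .
  moreover have "f z = g z * (z - b) ^ n" for z
    using r(3)[of b] r(1) by (auto simp: g_def)
  ultimately show ?thesis using that unfolding n_def by blast
qed

text \<open>Dividing out the other points leaves the order at a new point \<open>b\<close>
  unchanged, because their factors do not vanish there.\<close>

lemma holomorphic_factor_out_zeros:
  assumes f: "f holomorphic_on UNIV" and nz: "f w \<noteq> 0" and "finite A"
  shows "\<exists>g. g holomorphic_on UNIV \<and> (\<forall>z. f z = g z * (\<Prod>a\<in>A. (z - a) ^ nat (zorder f a)))"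
  using \<open>finite A\<close>
proof (induction A rule: finite_induct)
  case empty
  thus ?case using f by auto
next
  case (insert b A)
  let ?P = "\<lambda>z. \<Prod>a\<in>A. (z - a) ^ nat (zorder f a)"
  from insert.IH obtain g where g: "g holomorphic_on UNIV" "\<And>z. f z = g z * ?P z" by blast
  have ana: "g analytic_on {b}" "?P analytic_on {b}"
    using g(1) by (auto simp: analytic_at intro!: exI[of _ UNIV] holomorphic_intros)
  have "\<forall>\<^sub>F z in at b. f z \<noteq> 0 \<and> z \<in> UNIV"
    by (rule non_zero_neighbour_alt[OF f _ _ _ _ nz]) auto
  hence "\<forall>\<^sub>F z in at b. g z * ?P z \<noteq> 0" unfolding g(2)[symmetric] by simp
  from zorder_times_analytic[OF ana this]
  have "zorder f b = zorder g b + zorder ?P b" unfolding g(2)[symmetric] by simp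
  also have "zorder ?P b = 0"
    by (rule zorder_eq_0I[OF ana(2)]) (use insert.hyps in auto)
  finally have zo: "zorder f b = zorder g b" by simp
  have "g w \<noteq> 0" using nz g(2)[of w] by auto
  from holomorphic_factor_out_zero[OF g(1) this, of b] obtain h where
    h: "h holomorphic_on UNIV" "\<And>z. g z = h z * (z - b) ^ nat (zorder g b)" by blast
  have "f z = h z * (\<Prod>a\<in>insert b A. (z - a) ^ nat (zorder f a))" for z
  proof -
    have "f z = (h z * (z - b) ^ nat (zorder f b)) * ?P z" using g(2)[of z] h(2)[of z] by (simp only: zo)
    thus ?thesis using insert.hyps by (simp add: mult.assoc)
  qed
  with h(1) show ?case by blast
qed

text \<open>Divide the zeros out and apply the maximum principle to the quotient. On the circle of
  radius \<open>3 * R\<close> every factor has modulus at least \<open>2 * R\<close>, at the origin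
  at most \<open>R\<close>; so each zero costs a factor 2. The radius is chosen to get exactly this
  ratio.\<close>

lemma Jensen_zero_count:
  assumes f: "f holomorphic_on UNIV" and f0: "f 0 = 1" and R: "R > 0"
    and A: "finite A" "A \<subseteq> cball 0 R" and M: "\<And>z. norm z = 3 * R \<Longrightarrow> norm (f z) \<le> M"
  shows "2 ^ (\<Sum>a\<in>A. nat (zorder f a)) \<le> M"
proof -
  let ?m = "\<lambda>a. nat (zorder f a)"
  define N where "N = (\<Sum>a\<in>A. ?m a)"
  obtain g where g: "g holomorphic_on UNIV" "\<And>z. f z = g z * (\<Prod>a\<in>A. (z - a) ^ ?m a)"
    using holomorphic_factor_out_zeros[OF f _ A(1), of 0] f0 by auto
  have bound: "norm (g z) \<le> M / (2 * R) ^ N" if "norm z = 3 * R" for z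
  proof -
    have "(2 * R) ^ N = (\<Prod>a\<in>A. (2 * R) ^ ?m a)" unfolding N_def by (rule power_sum)
    also have "\<dots> \<le> (\<Prod>a\<in>A. norm (z - a) ^ ?m a)"
    proof (intro prod_mono conjI power_mono)
      fix a assume "a \<in> A"
      hence "norm a \<le> R" using A by auto
      thus "2 * R \<le> norm (z - a)" using norm_triangle_ineq2[of z a] that by simp
    qed (use R in auto)
    finally have "norm (g z) * (2 * R) ^ N \<le> norm (g z) * (\<Prod>a\<in>A. norm (z - a) ^ ?m a)"
      by (intro mult_left_mono) auto
    also have "\<dots> = norm (f z)" by (simp add: g(2) norm_mult norm_power prod_norm[symmetric])
    also have "\<dots> \<le> M" by (rule M[OF that])
    finally show ?thesis using R by (simp add: field_simps)
  qed
  have g0: "norm (g 0) \<le> M / (2 * R) ^ N"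
  proof (rule maximum_modulus_frontier[of g "ball 0 (3 * R)"])
    show "continuous_on (closure (ball 0 (3 * R))) g"
      by (rule holomorphic_on_imp_continuous_on[OF holomorphic_on_subset[OF g(1)]]) auto
    show "norm (g z) \<le> M / (2 * R) ^ N" if "z \<in> frontier (ball 0 (3 * R))" for z
      using that R by (intro bound) (simp add: frontier_ball)
  qed (use R in \<open>auto intro: holomorphic_on_subset[OF g(1)]\<close>)
  have "1 = norm (f 0)" by (simp add: f0)
  also have "\<dots> = norm (g 0) * (\<Prod>a\<in>A. norm a ^ ?m a)"
    by (simp add: g(2) norm_mult norm_power prod_norm[symmetric])
  also have "\<dots> \<le> norm (g 0) * (\<Prod>a\<in>A. R ^ ?m a)"
    using A by (intro mult_left_mono prod_mono conjI power_mono) auto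
  also have "(\<Prod>a\<in>A. R ^ ?m a) = R ^ N" unfolding N_def by (rule power_sum[symmetric])
  also have "norm (g 0) * R ^ N \<le> M / (2 * R) ^ N * R ^ N"
    using R by (intro mult_right_mono g0) auto
  also have "\<dots> = M / 2 ^ N" using R by (simp add: power_mult_distrib)
  finally show ?thesis by (simp add: N_def field_simps)
qed

text \<open>The hypothesis on \<open>K\<close> covers both arguments \<open>s / 2\<close> and
  \<open>(1 - s) / 2\<close>, whatever the sign of \<open>Re s\<close>.\<close>

lemma norm_riemann_xi_le:
  assumes "norm s / 2 + 2 \<le> real K"
  shows "norm (riemann_xi s) \<le> 1 + norm s * (norm s + 1) * (2 * theta_tail_const * fact K)"
proof -
  have "Re s \<le> norm s" "- Re s \<le> norm s" using abs_Re_le_cmod[of s] by linarith+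
  hence "norm (theta_mellin (s / 2)) \<le> theta_tail_const * fact K"
    "norm (theta_mellin ((1 - s) / 2)) \<le> theta_tail_const * fact K"
    using assms by (auto intro!: norm_theta_mellin_le simp: field_simps)
  hence "norm (completed_part s) \<le> 2 * theta_tail_const * fact K"
    unfolding completed_part_def by (intro norm_triangle_le) auto
  moreover have "norm (s - 1) \<le> norm s + 1" using norm_triangle_ineq4[of s 1] by simp
  ultimately have "norm (s * (s - 1) * completed_part s) \<le> norm s * (norm s + 1) * (2 * theta_tail_const * fact K)"
    unfolding norm_mult by (intro mult_mono) auto
  thus ?thesis unfolding riemann_xi_def by (intro norm_triangle_le) simp
qed

text \<open>A bound of order R log R for \<open>R = 2 ^ k\<close>. Everything is estimated by powers
  of 2, so that comparing exponents replaces taking logarithms.\<close>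

lemma zero_count_dyadic:
  obtains D where "\<And>A k. finite A \<Longrightarrow> A \<subseteq> cball 0 (2 ^ k) \<Longrightarrow>
    (\<Sum>a\<in>A. nat (zorder riemann_xi a)) \<le> D + 2 * k + (k + 2) * 2 ^ (k + 2)"
proof -
  \<comment> \<open>For \<open>norm z = 3 * 2 ^ k\<close> the polynomial factor is at most
    \<open>12 * 4 ^ k\<close>, and two transforms contribute; the 1 absorbs the constant summand of
    xi.\<close>
  define C where "C = 1 + 24 * theta_tail_const"
  have C0: "theta_tail_const \<ge> 0" unfolding theta_tail_const_def
    by (intro suminf_nonneg summable_exp_times_Suc) auto
  obtain D where D: "C \<le> 2 ^ D" using real_arch_pow[of 2 C] by (auto intro: less_imp_le)
  show ?thesis
  proof (rule that)
    fix A and k :: nat assume A: "finite A" "A \<subseteq> cball (0 :: complex) (2 ^ k)"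
    \<comment> \<open>At least half of \<open>3 * 2 ^ k\<close> plus 2, and at most
      \<open>2 ^ (k + 2)\<close>.\<close>
    define K where "K = (2 ^ (k + 1) + 2 :: nat)"
    let ?N = "\<Sum>a\<in>A. nat (zorder riemann_xi a)"
    have "(2::real) ^ ?N \<le> C * 4 ^ k * fact K"
    proof (rule Jensen_zero_count[OF holomorphic_riemann_xi riemann_xi_0 _ A])
      fix z :: complex assume z: "norm z = 3 * 2 ^ k"
      have p: "(1::real) \<le> 2 ^ k" by simp
      have "norm (riemann_xi z) \<le> 1 + norm z * (norm z + 1) * (2 * theta_tail_const * fact K)"
        by (rule norm_riemann_xi_le) (use p in \<open>simp add: z K_def\<close>)
      also have "norm z * (norm z + 1) \<le> (3 * 2 ^ k) * (4 * 2 ^ k)"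
        unfolding z using p by (intro mult_mono) auto
      also have "\<dots> = (12 * 4 ^ k :: real)" by (simp flip: power_mult_distrib)
      also have "1 + 12 * 4 ^ k * (2 * theta_tail_const * fact K) \<le> 4 ^ k * fact K + 12 * 4 ^ k * (2 * theta_tail_const * fact K)"
        using mult_mono[of 1 "4 ^ k :: real" 1 "fact K"] by simp
      also have "\<dots> = C * 4 ^ k * fact K" by (simp add: C_def algebra_simps)
      finally show "norm (riemann_xi z) \<le> C * 4 ^ k * fact K"
        using C0 by (simp add: mult_right_mono)
    qed simp
    also have "\<dots> \<le> 2 ^ D * 2 ^ (2 * k) * 2 ^ ((k + 2) * 2 ^ (k + 2))"
    proof (intro mult_mono D)
      have "K \<le> 2 ^ (k + 2)" by (simp add: K_def)
      have "(fact K :: real) \<le> real K ^ K" using fact_le_power[of K, where 'a = real] by simp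
      also have "\<dots> \<le> (2 ^ (k + 2)) ^ K"
        using \<open>K \<le> 2 ^ (k + 2)\<close> by (intro power_mono) (metis of_nat_le_iff of_nat_numeral of_nat_power, simp)
      also have "\<dots> \<le> (2 ^ (k + 2)) ^ (2 ^ (k + 2))"
        using \<open>K \<le> 2 ^ (k + 2)\<close> by (intro power_increasing one_le_power) auto
      also have "\<dots> = 2 ^ ((k + 2) * 2 ^ (k + 2))" by (rule power_mult[symmetric])
      finally show "(fact K :: real) \<le> 2 ^ ((k + 2) * 2 ^ (k + 2))" .
    qed (auto simp: power_mult)
    also have "\<dots> = 2 ^ (D + 2 * k + (k + 2) * 2 ^ (k + 2))" by (simp only: power_add)
    finally show "?N \<le> D + 2 * k + (k + 2) * 2 ^ (k + 2)" by (simp only: power_increasing_iff one_less_numeral_iff semiring_norm)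
  qed
qed

text \<open>In the open strip zeta and xi differ by a holomorphic factor without zeros:
  \<open>rGamma (s / 2)\<close> vanishes only when \<open>s / 2\<close> is a non-positive
  integer.\<close>

lemma zeta_strip:
  assumes "0 < Re \<rho>" "Re \<rho> < 1"
  shows "zeta \<rho> = 0 \<longleftrightarrow> riemann_xi \<rho> = 0" and "zorder zeta \<rho> = zorder riemann_xi \<rho>"
proof -
  define u where "u = (\<lambda>s. of_real pi powr (s / 2) * rGamma (s / 2) / (s * (s - 1)) :: complex)"
  define S where "S = {s. 0 < Re s} \<inter> {s. Re s < 1}"
  have S: "open S" "\<rho> \<in> S" using assms
    by (auto simp: S_def intro!: open_Int open_halfspace_Re_lt open_halfspace_Re_gt)
  have ne: "s \<noteq> 0" "s \<noteq> 1" if "s \<in> S" for s using that by (auto simp: S_def)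
  have eq: "zeta s = riemann_xi s * u s" if "s \<in> S" for s
    using ne[OF that] by (simp add: zeta_eq_formula zeta_formula_xi u_def)
  have uh: "u holomorphic_on S"
    unfolding u_def by (intro holomorphic_intros holomorphic_rGamma') (auto simp: ne)
  have "\<rho> / 2 \<notin> \<int>\<^sub>\<le>\<^sub>0" using assms by (auto elim!: nonpos_Ints_cases simp: complex_eq_iff)
  hence u0: "u \<rho> \<noteq> 0" using ne[OF S(2)] by (simp add: u_def rGamma_eq_zero_iff)
  show "zeta \<rho> = 0 \<longleftrightarrow> riemann_xi \<rho> = 0" using eq[OF S(2)] u0 by simp
  have ana: "riemann_xi analytic_on {\<rho>}" "u analytic_on {\<rho>}"
    using S uh holomorphic_riemann_xi[of S] by (auto intro!: analytic_at[THEN iffD2])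
  have "\<forall>\<^sub>F s in at \<rho>. riemann_xi s \<noteq> 0 \<and> s \<in> UNIV"
    by (rule non_zero_neighbour_alt[OF holomorphic_riemann_xi _ _ _ _, of _ _ 0]) (auto simp: riemann_xi_0)
  moreover have "\<forall>\<^sub>F s in at \<rho>. u s \<noteq> 0"
    using analytic_at_imp_isCont[OF ana(2)] u0 unfolding isCont_def by (rule tendsto_imp_eventually_ne)
  ultimately have ev: "\<forall>\<^sub>F s in at \<rho>. riemann_xi s * u s \<noteq> 0" by eventually_elim auto
  have "\<forall>\<^sub>F s in at \<rho>. s \<in> S" using S by (rule eventually_at_in_open')
  hence "zorder zeta \<rho> = zorder (\<lambda>s. riemann_xi s * u s) \<rho>"
    by (intro zorder_cong) (auto elim!: eventually_mono simp: eq)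
  also have "\<dots> = zorder riemann_xi \<rho> + zorder u \<rho>" by (rule zorder_times_analytic[OF ana ev])
  also have "zorder u \<rho> = 0" by (rule zorder_eq_0I[OF ana(2) u0])
  finally show "zorder zeta \<rho> = zorder riemann_xi \<rho>" by simp
qed

lemma zorder_riemann_xi_pos: "riemann_xi \<rho> = 0 \<Longrightarrow> zorder riemann_xi \<rho> > 0"
proof -
  assume z: "riemann_xi \<rho> = 0"
  have "\<forall>\<^sub>F s in at \<rho>. riemann_xi s \<noteq> 0 \<and> s \<in> UNIV"
    by (rule non_zero_neighbour_alt[OF holomorphic_riemann_xi _ _ _ _, of _ _ 0]) (auto simp: riemann_xi_0)
  hence "\<exists>\<^sub>F s in at \<rho>. riemann_xi s \<noteq> 0"
    by (intro eventually_frequently) (auto elim: eventually_mono)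
  from zorder_pos_iff[OF holomorphic_riemann_xi open_UNIV UNIV_I this] z show ?thesis by simp
qed

lemma nontrivial_zeros_xi: "nontrivial_zeros = {\<rho>. riemann_xi \<rho> = 0 \<and> 0 < Re \<rho> \<and> Re \<rho> < 1}"
  unfolding nontrivial_zeros_def using zeta_strip(1) by auto

lemma nontrivial_zeros_reflect: "\<rho> \<in> nontrivial_zeros \<Longrightarrow> 1 - \<rho> \<in> nontrivial_zeros"
  by (simp add: nontrivial_zeros_xi riemann_xi_reflect)

lemma zorder_nontrivial_zero_pos: "\<rho> \<in> nontrivial_zeros \<Longrightarrow> zorder zeta \<rho> > 0"
  using zorder_riemann_xi_pos zeta_strip(2)[of \<rho>] by (auto simp: nontrivial_zeros_xi)

lemma finite_nontrivial_zeros_cball: "finite (nontrivial_zeros \<inter> cball 0 r)"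
proof -
  \<comment> \<open>A constant xi would be identically 1 and have no zeros, so this case needs no
    separate exclusion.\<close>
  have "\<not> riemann_xi constant_on UNIV \<or> (\<forall>z. riemann_xi z = 1)"
    using riemann_xi_0 by (auto simp: constant_on_def) metis
  thus ?thesis
  proof
    assume "\<not> riemann_xi constant_on UNIV"
    hence "finite {z \<in> cball 0 r. riemann_xi z = 0}"
      by (intro holomorphic_compact_finite_zeros[OF holomorphic_riemann_xi]) auto
    thus ?thesis by (rule rev_finite_subset) (auto simp: nontrivial_zeros_xi)
  qed (simp add: nontrivial_zeros_xi)
qed

text \<open>Dyadic shells: between the radii \<open>2 ^ l\<close> and \<open>2 ^ Suc l\<close> there
  are O(l 2^l) zeros, each of weight at most \<open>1 / 4 ^ l\<close> per unit of multiplicity, and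
  l / 2^l is summable.\<close>

lemma zero_multiplicities_summable:
  "(\<lambda>\<rho>. of_int (zorder zeta \<rho>) / (norm \<rho>)\<^sup>2) summable_on nontrivial_zeros"
proof (rule nonneg_bdd_above_summable_on)
  let ?w = "\<lambda>\<rho>. of_int (zorder zeta \<rho>) / (norm \<rho>)\<^sup>2 :: real"
  show w_nonneg: "?w \<rho> \<ge> 0" if "\<rho> \<in> nontrivial_zeros" for \<rho>
    using zorder_nontrivial_zero_pos[OF that] by simp
  obtain D where D: "\<And>A k. finite A \<Longrightarrow> A \<subseteq> cball 0 (2 ^ k) \<Longrightarrow>
    (\<Sum>a\<in>A. nat (zorder riemann_xi a)) \<le> D + 2 * k + (k + 2) * 2 ^ (k + 2)"
    using zero_count_dyadic by blast
  define b' where "b' = (\<lambda>k. real (D + 2 * Suc k + (Suc k + 2) * 2 ^ (Suc k + 2)) / 4 ^ k)"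
  \<comment> \<open>Index 0 is the closed unit disc, where the finite sum itself is the bound. Index
    \<open>Suc l\<close> is the shell beyond radius \<open>2 ^ l\<close>, counted by the disc of
    radius \<open>2 ^ Suc l\<close>.\<close>
  define b where "b = (\<lambda>k. case k of 0 \<Rightarrow> sum ?w (nontrivial_zeros \<inter> cball 0 1) | Suc k \<Rightarrow> b' k)"
  have b'_eq: "b' = (\<lambda>k. (real D + 2 * real k + 2) / 4 ^ k + 8 * (real k + 3) / 2 ^ k)"
  proof
    fix k
    have "(4::real) ^ k = 2 ^ k * 2 ^ k" by (simp flip: power_mult_distrib)
    thus "b' k = (real D + 2 * real k + 2) / 4 ^ k + 8 * (real k + 3) / 2 ^ k"
      by (simp add: b'_def power_add field_simps)
  qed
  have sq: "summable (\<lambda>k. norm (inverse (real k ^ 2)))" using inverse_power_summable[of 2] by simp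
  have "summable b'" unfolding b'_eq
  proof (intro summable_add)
    show "summable (\<lambda>k. (real D + 2 * real k + 2) / 4 ^ k)"
      by (rule summable_comparison_test_bigo[OF sq]) real_asymp
    show "summable (\<lambda>k. 8 * (real k + 3) / 2 ^ k)"
      by (rule summable_comparison_test_bigo[OF sq]) real_asymp
  qed
  hence b: "summable b" by (subst summable_Suc_iff[symmetric]) (simp add: b_def)
  have b_nonneg: "b k \<ge> 0" for k
    using w_nonneg by (cases k) (auto simp: b_def b'_def intro!: sum_nonneg)
  have "sum ?w F \<le> suminf b" if F: "F \<subseteq> nontrivial_zeros" "finite F" for F
  proof -
    define g where "g = (\<lambda>\<rho>::complex. LEAST k. norm \<rho> \<le> 2 ^ k)"
    have g: "norm \<rho> \<le> 2 ^ g \<rho>" for \<rho>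
    proof -
      obtain k where "norm \<rho> < 2 ^ k" using real_arch_pow[of 2 "norm \<rho>"] by (metis one_less_numeral_iff semiring_norm(76))
      hence "norm \<rho> \<le> 2 ^ k" by simp
      thus ?thesis unfolding g_def by (rule LeastI[of "\<lambda>k. norm \<rho> \<le> 2 ^ k"])
    qed
    have g_less: "norm \<rho> > 2 ^ k" if "g \<rho> = Suc k" for \<rho> k
    proof -
      have "k < (LEAST k. norm \<rho> \<le> 2 ^ k)" using that unfolding g_def by linarith
      from not_less_Least[OF this] show ?thesis by simp
    qed
    have cell: "(\<Sum>\<rho>\<in>{\<rho>\<in>F. g \<rho> = k}. ?w \<rho>) \<le> b k" for k
    proof (cases k)
      case 0
      have "(\<Sum>\<rho>\<in>{\<rho>\<in>F. g \<rho> = k}. ?w \<rho>) \<le> sum ?w (nontrivial_zeros \<inter> cball 0 1)"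
      proof (rule sum_mono2[OF finite_nontrivial_zeros_cball])
        show "{\<rho>\<in>F. g \<rho> = k} \<subseteq> nontrivial_zeros \<inter> cball 0 1"
        proof
          fix \<rho> assume "\<rho> \<in> {\<rho>\<in>F. g \<rho> = k}"
          thus "\<rho> \<in> nontrivial_zeros \<inter> cball 0 1" using F(1) g[of \<rho>] by (auto simp: 0)
        qed
      qed (use w_nonneg in auto)
      thus ?thesis by (simp add: b_def 0)
    next
      case (Suc l)
      let ?A = "{\<rho>\<in>F. g \<rho> = k}"
      have "(\<Sum>\<rho>\<in>?A. ?w \<rho>) \<le> (\<Sum>\<rho>\<in>?A. real (nat (zorder riemann_xi \<rho>)) / 4 ^ l)"
      proof (rule sum_mono)
        fix \<rho> assume \<rho>: "\<rho> \<in> ?A"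
        hence z: "\<rho> \<in> nontrivial_zeros" using F by auto
        have "(2 ^ l)\<^sup>2 \<le> (norm \<rho>)\<^sup>2" using g_less[of \<rho> l] \<rho> by (intro power_mono) (auto simp: Suc)
        hence n: "4 ^ l \<le> (norm \<rho>)\<^sup>2" by (simp add: power2_eq_square flip: power_mult_distrib)
        have "zorder zeta \<rho> = zorder riemann_xi \<rho>" "zorder zeta \<rho> > 0"
          using z zeta_strip(2) zorder_nontrivial_zero_pos by (auto simp: nontrivial_zeros_def)
        thus "?w \<rho> \<le> real (nat (zorder riemann_xi \<rho>)) / 4 ^ l"
          using n by (auto intro!: frac_le)
      qed
      also have "\<dots> = real (\<Sum>\<rho>\<in>?A. nat (zorder riemann_xi \<rho>)) / 4 ^ l"
        by (simp add: sum_divide_distrib)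
      also have "\<dots> \<le> b' l"
        unfolding b'_def
      proof (intro divide_right_mono of_nat_mono D)
        show "?A \<subseteq> cball 0 (2 ^ Suc l)"
        proof
          fix \<rho> assume "\<rho> \<in> ?A"
          thus "\<rho> \<in> cball 0 (2 ^ Suc l)" using g[of \<rho>] by (simp add: Suc)
        qed
      qed (use F in auto)
      finally show ?thesis by (simp add: b_def Suc)
    qed
    have "sum ?w F = (\<Sum>k\<in>g ` F. \<Sum>\<rho>\<in>{\<rho>\<in>F. g \<rho> = k}. ?w \<rho>)"
      by (rule sum.group[symmetric]) (use F in auto)
    also have "\<dots> \<le> sum b (g ` F)" by (intro sum_mono cell)
    also have "\<dots> \<le> suminf b" using F by (intro sum_le_suminf b b_nonneg) auto
    finally show ?thesis .
  qed
  thus "bdd_above (sum ?w ` {F. F \<subseteq> nontrivial_zeros \<and> finite F})"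
    by (intro bdd_aboveI[of _ "suminf b"]) auto
qed

definition zero_coeff :: "complex \<Rightarrow> complex" where
  "zero_coeff \<rho> = of_int (zorder zeta \<rho>) / (\<rho> * (\<rho> + 1))"

lemma zero_coeff_summable: "(\<lambda>\<rho>. norm (zero_coeff \<rho>)) summable_on nontrivial_zeros"
proof (rule summable_on_comparison_test[OF zero_multiplicities_summable])
  fix \<rho> assume \<rho>: "\<rho> \<in> nontrivial_zeros"
  hence "0 < Re \<rho>" by (simp add: nontrivial_zeros_def)
  have "norm \<rho> \<le> norm (\<rho> + 1)"
    unfolding cmod_def using \<open>0 < Re \<rho>\<close> by (intro real_sqrt_le_mono) (simp add: power2_eq_square algebra_simps)
  moreover have "norm \<rho> > 0" using \<open>0 < Re \<rho>\<close> by auto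
  ultimately have "(norm \<rho>)\<^sup>2 \<le> norm (\<rho> * (\<rho> + 1))"
    by (simp add: norm_mult power2_eq_square)
  thus "norm (zero_coeff \<rho>) \<le> of_int (zorder zeta \<rho>) / (norm \<rho>)\<^sup>2"
    using zorder_nontrivial_zero_pos[OF \<rho>] \<open>norm \<rho> > 0\<close>
    by (simp add: zero_coeff_def norm_divide frac_le)
qed auto

section \<open>Vanishing averages force boundedness\<close>

text \<open>Uniform continuity makes the oscillation on every cell of small length at most
  \<open>e'\<close>, so the Riemann sum differs from the integral by at most \<open>e'\<close> times
  the total length.\<close>

lemma continuous_imp_riemann_integrable:
  fixes f :: "real \<Rightarrow> 'a :: banach"
  assumes f: "continuous_on {a..b} f" and "a \<le> b"
  shows "riemann_integrable_on f a b"
  unfolding riemann_integrable_on_def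
proof (intro exI[of _ "integral {a..b} f"] allI impI)
  fix e :: real assume "e > 0"
  \<comment> \<open>The added 1 keeps the quotient meaningful for \<open>a = b\<close> and the final
    inequality strict.\<close>
  define e' where "e' = e / (b - a + 1)"
  have e': "e' > 0" "e' * (b - a) < e" using \<open>e > 0\<close> \<open>a \<le> b\<close> by (auto simp: e'_def field_simps)
  have "uniformly_continuous_on {a..b} f"
    by (intro compact_uniformly_continuous f) auto
  then obtain d where d: "d > 0" "\<And>x y. x \<in> {a..b} \<Longrightarrow> y \<in> {a..b} \<Longrightarrow> dist x y < d \<Longrightarrow> dist (f x) (f y) < e'"
    using e'(1) unfolding uniformly_continuous_on_def by metis
  show "\<exists>d>0. \<forall>p. p tagged_division_of {a..b} \<and> (\<forall>(x, K)\<in>p. measure lborel K < d) \<longrightarrow>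
        norm ((\<Sum>(x, K)\<in>p. measure lborel K *\<^sub>R f x) - integral {a..b} f) < e"
  proof (intro exI[of _ d] conjI allI impI d(1))
    fix p assume "p tagged_division_of {a..b} \<and> (\<forall>(x, K)\<in>p. measure lborel K < d)"
    hence p: "p tagged_division_of (cbox a b)" and small: "\<And>x K. (x, K) \<in> p \<Longrightarrow> measure lborel K < d" by auto
    have int: "f integrable_on cbox a b" using f by (intro integrable_continuous) auto
    have cell: "norm (measure lborel K *\<^sub>R f x - integral K f) \<le> e' * measure lborel K" if xK: "(x, K) \<in> p" for x K
    proof -
      have K: "x \<in> K" "K \<subseteq> {a..b}" using tagged_division_ofD(2,3)[OF p xK] by auto
      obtain u v where uv: "K = cbox u v" using tagged_division_ofD(4)[OF p xK] by blast
      have "u \<le> v" using K uv by auto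
      have meas: "measure lborel K = v - u" using uv \<open>u \<le> v\<close> by simp
      have fK: "f integrable_on K" unfolding uv using K uv by (intro integrable_continuous continuous_on_subset[OF f]) auto
      have "((\<lambda>y. f x - f y) has_integral measure lborel K *\<^sub>R f x - integral K f) K"
        using has_integral_diff[OF has_integral_const[of "f x" u v], of f "integral K f"] fK uv by (simp add: has_integral_integral)
      moreover have "norm (f x - f y) \<le> e'" if "y \<in> K" for y
      proof -
        have "dist x y < d" using small[OF \<open>(x, K) \<in> p\<close>] meas K that uv by (auto simp: dist_real_def)
        moreover have "x \<in> {a..b}" "y \<in> {a..b}" using K that by auto
        ultimately show ?thesis using d(2)[of x y] by (simp add: dist_norm)
      qed
      ultimately show ?thesis using has_integral_bound[of e' "\<lambda>y. f x - f y" _ u v] e'(1) uv by simp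
    qed
    have "(\<Sum>(x, K)\<in>p. measure lborel K *\<^sub>R f x) - integral {a..b} f =
          (\<Sum>(x, K)\<in>p. measure lborel K *\<^sub>R f x - integral K f)"
      using integral_combine_tagged_division_topdown[OF int p]
      by (simp add: case_prod_unfold sum_subtractf)
    also have "norm \<dots> \<le> (\<Sum>(x, K)\<in>p. e' * measure lborel K)"
      by (rule order.trans[OF norm_sum sum_mono]) (use cell in auto)
    also have "\<dots> = e' * (\<Sum>(x, K)\<in>p. measure lborel K)"
      by (simp add: sum_distrib_left case_prod_unfold)
    also have "(\<Sum>(x, K)\<in>p. measure lborel K) = b - a"
      using additive_content_tagged_division[OF p] \<open>a \<le> b\<close> by simp
    also note e'(2)
    finally show "norm ((\<Sum>(x, K)\<in>p. measure lborel K *\<^sub>R f x) - integral {a..b} f) < e" .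
  qed
qed

text \<open>A locally finite sum of ramps: the \<open>k\<close>-th starts at \<open>k\<close> with
  slope \<open>c k\<close>, hence has reached \<open>c k\<close> at \<open>k + 1\<close>.\<close>

lemma continuous_dominating_function:
  fixes c :: "nat \<Rightarrow> real"
  assumes c: "\<And>n. c n \<ge> 0"
  obtains \<phi> :: "real \<Rightarrow> real" where "continuous_on UNIV \<phi>" "\<And>y. \<phi> y \<ge> 0" "\<And>y. y \<le> 0 \<Longrightarrow> \<phi> y = 0"
    "\<And>n y. y \<ge> real n + 1 \<Longrightarrow> \<phi> y \<ge> c n"
proof -
  define \<phi> where "\<phi> = (\<lambda>y::real. \<Sum>k<nat \<lceil>y\<rceil>. c k * max 0 (y - real k))"
  have eq: "\<phi> y = (\<Sum>k<N. c k * max 0 (y - real k))" if "y \<le> real N" for y N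
    unfolding \<phi>_def
  proof (rule sum.mono_neutral_left)
    show "{..<nat \<lceil>y\<rceil>} \<subseteq> {..<N}" using that by (auto simp: nat_less_iff ceiling_le_iff)
    show "\<forall>k\<in>{..<N} - {..<nat \<lceil>y\<rceil>}. c k * max 0 (y - real k) = 0"
    proof
      fix k assume "k \<in> {..<N} - {..<nat \<lceil>y\<rceil>}"
      hence "y \<le> real k" by (auto simp: not_less)
      thus "c k * max 0 (y - real k) = 0" by simp
    qed
  qed auto
  have "isCont \<phi> y" for y
  proof -
    obtain N :: nat where N: "y < real N" using reals_Archimedean2 by blast
    have "\<forall>\<^sub>F z in nhds y. z \<in> {..<real N}" using N by (intro eventually_nhds_in_open) auto
    hence "\<forall>\<^sub>F z in nhds y. \<phi> z = (\<Sum>k<N. c k * max 0 (z - real k))"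
      by eventually_elim (auto intro!: eq)
    moreover have "isCont (\<lambda>z. \<Sum>k<N. c k * max 0 (z - real k)) y"
      by (intro continuous_intros)
    ultimately show ?thesis by (subst isCont_cong) auto
  qed
  hence "continuous_on UNIV \<phi>" by (simp add: continuous_at_imp_continuous_on)
  moreover have "\<phi> y \<ge> 0" for y unfolding \<phi>_def using c by (intro sum_nonneg mult_nonneg_nonneg) auto
  moreover have "\<phi> y = 0" if "y \<le> 0" for y using that unfolding \<phi>_def by simp
  moreover have "\<phi> y \<ge> c n" if "y \<ge> real n + 1" for n y
  proof -
    have n: "n \<in> {..<nat \<lceil>y\<rceil>}" using that by simp linarith
    have "c n * 1 \<le> c n * max 0 (y - real n)" using that c by (intro mult_left_mono) auto
    also have "\<dots> \<le> \<phi> y" unfolding \<phi>_def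
      by (rule member_le_sum[OF n]) (use c in auto)
    finally show ?thesis by simp
  qed
  ultimately show ?thesis using that by blast
qed

text \<open>If h is unbounded, every level \<open>n\<close> is exceeded on some interval starting at
  \<open>t n\<close> of width \<open>\<delta> n\<close>. The test function is taken so large at that
  level that this one interval contributes \<open>T\<close> to the integral over
  \<open>{0..T}\<close>, for a suitable \<open>T\<close>. Then the averages return to at least 1 for
  arbitrarily large \<open>T\<close>.\<close>

lemma bounded_of_vanishing_averages:
  fixes h :: "real \<Rightarrow> real" and K :: real
  assumes h: "continuous_on {0..} h"
    and avg: "\<And>\<Phi> :: real \<Rightarrow> real. continuous_on UNIV \<Phi> \<Longrightarrow> (\<And>u. \<bar>u\<bar> \<le> K \<Longrightarrow> \<Phi> u = 0) \<Longrightarrow>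
      ((\<lambda>T. 1 / T * integral {0..T} (\<lambda>t. \<Phi> (h t))) \<longlongrightarrow> 0) at_top"
  shows "bounded (h ` {0..})"
proof (rule ccontr)
  assume nb: "\<not> bounded (h ` {0..})"
  have "\<exists>t \<delta>. t \<ge> 0 \<and> \<delta> > 0 \<and> \<delta> \<le> 1 \<and> (\<forall>x\<in>{t..t+\<delta>}. \<bar>h x\<bar> - K \<ge> real n + 1)" for n :: nat
  proof -
    obtain t where t: "t \<ge> 0" "\<bar>h t\<bar> > K + real n + 1"
      using nb unfolding bounded_iff by (force simp: not_le)
    have "continuous_on {0..} (\<lambda>t. \<bar>h t\<bar>)" using h by (intro continuous_intros)
    then obtain d where d: "d > 0" "\<And>x. x \<ge> 0 \<Longrightarrow> dist x t < d \<Longrightarrow> dist \<bar>h x\<bar> \<bar>h t\<bar> < \<bar>h t\<bar> - (K + real n + 1)"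
      unfolding continuous_on_iff using t by (metis atLeast_iff diff_gt_0_iff_gt)
    have "\<bar>h x\<bar> - K \<ge> real n + 1" if "x \<in> {t..t + min 1 (d/2)}" for x
    proof -
      have x: "x \<ge> 0" "\<bar>x - t\<bar> < d" using that t d(1) by (auto simp: min_def split: if_splits)
      from d(2)[of x] x show ?thesis by (auto simp: dist_real_def)
    qed
    thus ?thesis using t d(1) by (intro exI[of _ t] exI[of _ "min 1 (d/2)"]) auto
  qed
  then obtain t \<delta> where t: "\<And>n. t n \<ge> 0" and \<delta>: "\<And>n. \<delta> n > 0" "\<And>n. \<delta> n \<le> 1"
    and big: "\<And>n x. x \<in> {t n..t n + \<delta> n} \<Longrightarrow> \<bar>h x\<bar> - K \<ge> real n + 1" by metis
  \<comment> \<open>Height times width equals \<open>t n + n + 1\<close>, the length of the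
    averaging interval used below.\<close>
  define c where "c = (\<lambda>n. (t n + real n + 1) / \<delta> n)"
  have c: "c n \<ge> 0" for n using t[of n] \<delta>(1)[of n] by (simp add: c_def)
  obtain \<phi> :: "real \<Rightarrow> real" where \<phi>: "continuous_on UNIV \<phi>" "\<And>y. \<phi> y \<ge> 0" "\<And>y. y \<le> 0 \<Longrightarrow> \<phi> y = 0"
    "\<And>n y. y \<ge> real n + 1 \<Longrightarrow> \<phi> y \<ge> c n" using continuous_dominating_function[of c] c by blast
  define \<Phi> where "\<Phi> = (\<lambda>u. \<phi> (\<bar>u\<bar> - K))"
  have \<Phi>c: "continuous_on A \<Phi>" for A unfolding \<Phi>_def
    by (intro continuous_on_compose2[OF \<phi>(1)] continuous_intros) auto
  have \<Phi>h: "(\<lambda>x. \<Phi> (h x)) integrable_on {a..b}" if "a \<ge> 0" for a b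
    by (intro integrable_continuous_interval continuous_on_compose2[OF \<Phi>c[of UNIV]] continuous_on_subset[OF h])
       (use that in auto)
  have "((\<lambda>T. 1 / T * integral {0..T} (\<lambda>x. \<Phi> (h x))) \<longlongrightarrow> 0) at_top"
    by (rule avg[OF \<Phi>c]) (auto simp: \<Phi>_def intro!: \<phi>(3))
  hence "\<forall>\<^sub>F T in at_top. 1 / T * integral {0..T} (\<lambda>x. \<Phi> (h x)) < 1"
    by (rule order_tendstoD) simp
  then obtain T0 where T0: "\<And>T. T \<ge> T0 \<Longrightarrow> 1 / T * integral {0..T} (\<lambda>x. \<Phi> (h x)) < 1"
    unfolding eventually_at_top_linorder by blast
  obtain n :: nat where n: "real n \<ge> T0" using real_arch_simple by blast
  \<comment> \<open>The summand \<open>n\<close> forces \<open>T\<close> past \<open>T0\<close>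
    without any information on \<open>t n\<close>; the 1 makes room for the width, which is at most
    1.\<close>
  define T where "T = t n + real n + 1"
  have T: "T \<ge> T0" "T > 0" using n t[of n] by (auto simp: T_def)
  have sub: "{t n..t n + \<delta> n} \<subseteq> {0..T}" using t[of n] \<delta>[of n] by (auto simp: T_def)
  have "T = integral {t n..t n + \<delta> n} (\<lambda>_. c n)" using \<delta>(1)[of n] by (simp add: c_def T_def)
  also have "\<dots> \<le> integral {t n..t n + \<delta> n} (\<lambda>x. \<Phi> (h x))"
    by (intro integral_le \<Phi>h t) (use big \<phi>(4) in \<open>auto simp: \<Phi>_def\<close>)
  also have "\<dots> \<le> integral {0..T} (\<lambda>x. \<Phi> (h x))"
    by (intro integral_subset_le sub \<Phi>h t) (auto simp: \<Phi>_def \<phi>(2))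
  finally have "1 / T * integral {0..T} (\<lambda>x. \<Phi> (h x)) \<ge> 1" using T by (simp add: field_simps)
  with T0[OF T(1)] show False by simp
qed

section \<open>Bounded exponential sums\<close>

text \<open>Discreteness is expressed by finiteness in every disc. Outside the disc of radius
  \<open>norm z + 1\<close> all points are at distance at least 1, so finitely many remain to be
  avoided.\<close>

lemma discrete_isolated_ball:
  fixes I :: "complex set"
  assumes "\<And>r. finite (I \<inter> cball 0 r)" "z \<notin> I"
  obtains d where "d > 0" "\<And>w. w \<in> I \<Longrightarrow> d \<le> dist z w"
proof -
  define F where "F = I \<inter> cball 0 (norm z + 1)"
  have "finite F" "z \<notin> F" using assms by (auto simp: F_def)
  from finite_set_avoid[OF this(1), of z] obtain d where d: "d > 0" "\<And>w. w \<in> F \<Longrightarrow> w \<noteq> z \<Longrightarrow> d \<le> dist z w" by blast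
  show ?thesis
  proof (rule that[of "min 1 d"])
    fix w assume w: "w \<in> I"
    show "min 1 d \<le> dist z w"
    proof (cases "w \<in> F")
      case True
      with d(2)[of w] \<open>z \<notin> F\<close> show ?thesis by force
    next
      case False
      hence "norm w > norm z + 1" using w by (auto simp: F_def)
      moreover have "norm w \<le> norm z + dist z w"
        using norm_triangle_sub[of w z] by (simp add: dist_norm norm_minus_commute)
      ultimately show ?thesis by linarith
    qed
  qed (use d in auto)
qed

lemma discrete_closed:
  fixes I :: "complex set"
  assumes "\<And>r. finite (I \<inter> cball 0 r)"
  shows "closed I"
  unfolding closed_def open_dist
proof (intro ballI)
  fix z assume "z \<in> - I"
  then obtain d where "d > 0" "\<And>w. w \<in> I \<Longrightarrow> d \<le> dist z w"
    using discrete_isolated_ball[OF assms] by (metis ComplD)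
  thus "\<exists>e>0. \<forall>y. dist y z < e \<longrightarrow> y \<in> - I"
    by (intro exI[of _ d]) (auto simp: dist_commute not_le[symmetric])
qed

lemma discrete_countable:
  fixes I :: "complex set"
  assumes "\<And>r. finite (I \<inter> cball 0 r)"
  shows "countable I"
proof -
  have "\<exists>n. w \<in> cball 0 (real n)" for w :: complex
    using real_arch_simple[of "norm w"] by simp
  hence "I = (\<Union>n. I \<inter> cball 0 (real n))" by blast
  also have "countable \<dots>" by (intro countable_UN countable_finite[OF assms] countableI_type)
  finally show ?thesis .
qed

text \<open>Near a point off \<open>I\<close> all poles stay at distance at least
  \<open>d / 2\<close>, so the absolutely summable coefficients give uniform convergence of the
  partial sums over finite subsets.\<close>

lemma simple_pole_sum_holomorphic:
  fixes c :: "complex \<Rightarrow> complex"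
  assumes I: "\<And>r. finite (I \<inter> cball 0 r)" and c: "(\<lambda>w. norm (c w)) summable_on I"
  shows "(\<lambda>z. \<Sum>\<^sub>\<infinity>w\<in>I. c w / (z - w)) holomorphic_on - I"
proof -
  have op: "open (- I)" using discrete_closed[OF I] by auto
  have "(\<lambda>z. \<Sum>\<^sub>\<infinity>w\<in>I. c w / (z - w)) field_differentiable at z" if "z \<in> - I" for z
  proof -
    obtain d where d: "d > 0" "\<And>w. w \<in> I \<Longrightarrow> d \<le> dist z w" using discrete_isolated_ball[OF I, of z] \<open>z \<in> - I\<close> by auto
    have far: "dist y w \<ge> d / 2" if "y \<in> cball z (d / 2)" "w \<in> I" for y w
      using d(2)[OF that(2)] that(1) dist_triangle[of z w y] by (simp add: dist_commute)
    have ulim: "uniform_limit (cball z (d / 2)) (\<lambda>F z. \<Sum>w\<in>F. c w / (z - w)) (\<lambda>z. \<Sum>\<^sub>\<infinity>w\<in>I. c w / (z - w)) (finite_subsets_at_top I)"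
    proof (rule Weierstrass_m_test_general)
      show "(\<lambda>w. norm (c w) * inverse (d / 2)) summable_on I"
        using c by (rule summable_on_cmult_left)
      show "norm (c w / (y - w)) \<le> norm (c w) * inverse (d / 2)" if "w \<in> I" "y \<in> cball z (d / 2)" for w y
        unfolding divide_inverse[symmetric] norm_divide
        using far[OF that(2,1)] d(1) by (intro frac_le) (auto simp: dist_norm)
    qed
    have ev: "\<forall>\<^sub>F F in finite_subsets_at_top I. continuous_on (cball z (d / 2)) (\<lambda>z. \<Sum>w\<in>F. c w / (z - w)) \<and>
        (\<lambda>z. \<Sum>w\<in>F. c w / (z - w)) holomorphic_on ball z (d / 2)"
    proof (rule eventually_finite_subsets_at_top_weakI)
      fix F assume F: "F \<subseteq> I"
      have ne: "y - w \<noteq> 0" if "y \<in> cball z (d / 2)" "w \<in> F" for y w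
        using far[of y w] that F d(1) by auto
      have "(\<lambda>z. \<Sum>w\<in>F. c w / (z - w)) holomorphic_on cball z (d / 2)"
        by (intro holomorphic_intros ne)
      thus "continuous_on (cball z (d / 2)) (\<lambda>z. \<Sum>w\<in>F. c w / (z - w)) \<and>
        (\<lambda>z. \<Sum>w\<in>F. c w / (z - w)) holomorphic_on ball z (d / 2)"
        using holomorphic_on_imp_continuous_on holomorphic_on_subset ball_subset_cball by blast
    qed
    have "(\<lambda>z. \<Sum>\<^sub>\<infinity>w\<in>I. c w / (z - w)) holomorphic_on ball z (d / 2)"
      by (rule holomorphic_uniform_limit[OF ev ulim finite_subsets_at_top_neq_bot])
    thus ?thesis using d(1) by (intro holomorphic_on_imp_differentiable_at[of _ "ball z (d / 2)"]) auto
  qed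
  thus ?thesis by (simp add: holomorphic_on_def field_differentiable_at_within)
qed

text \<open>The interchange is done by a tail estimate: after removing a finite \<open>F\<close>,
  the remainder is at most \<open>exp (\<sigma> * t)\<close> times the remaining coefficient mass,
  and its transform at most that mass divided by \<open>k\<close>. This tends to 0 along the finite
  subsets of \<open>I\<close>.\<close>

lemma exponential_sum_laplace:
  fixes c :: "complex \<Rightarrow> complex" and h :: "real \<Rightarrow> complex"
  assumes c: "(\<lambda>w. norm (c w)) summable_on I" and I: "\<And>w. w \<in> I \<Longrightarrow> Re w \<le> \<sigma>"
    and h: "continuous_on {0..} h" "\<And>t. t \<ge> 0 \<Longrightarrow> ((\<lambda>w. c w * exp (w * t)) has_sum h t) I"
    and u: "Re u < - \<sigma>"
  shows "((\<lambda>w. - c w / (u + w)) has_sum (LINT t:{0..}|lborel. h t * exp (u * t))) I"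
proof -
  define k where "k = - (\<sigma> + Re u)"
  have k: "k > 0" using u by (simp add: k_def)
  let ?L = "LINT t:{0..}|lborel. h t * exp (u * t)"
  define S where "S = (\<Sum>\<^sub>\<infinity>w\<in>I. norm (c w))"
  have bound: "norm ((\<Sum>w\<in>F. - c w / (u + w)) - ?L) \<le> (S - (\<Sum>w\<in>F. norm (c w))) / k"
    if F: "finite F" "F \<subseteq> I" for F
  proof -
    let ?r = "\<lambda>t::real. h t * exp (u * t) - (\<Sum>w\<in>F. c w * exp (- (- (u + w)) * t))"
    have tail: "(\<Sum>\<^sub>\<infinity>w\<in>I - F. norm (c w)) = S - (\<Sum>w\<in>F. norm (c w))"
      unfolding S_def using infsum_Diff[OF c, of F] F by (simp add: summable_on_finite)
    have sumF: "(\<lambda>w. norm (c w)) summable_on (I - F)"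
      by (rule summable_on_subset_banach[OF c]) auto
    have rb: "norm (?r t) \<le> (S - (\<Sum>w\<in>F. norm (c w))) * exp (- k * t)" if t: "t \<ge> 0" for t
    proof -
      have hs: "((\<lambda>w. c w * exp (w * t)) has_sum (h t - (\<Sum>w\<in>F. c w * exp (w * t)))) (I - F)"
        by (rule has_sum_Diff[OF h(2)[OF t] has_sum_finite[OF F(1)] F(2)])
      have nle: "norm (c w * exp (w * t)) \<le> norm (c w) * exp (\<sigma> * t)" if "w \<in> I - F" for w
      proof -
        have "Re w * t \<le> \<sigma> * t" using I[of w] that t by (intro mult_right_mono) auto
        thus ?thesis by (simp add: norm_mult mult_left_mono)
      qed
      have hs': "((\<lambda>w. norm (c w) * exp (\<sigma> * t)) has_sum ((S - (\<Sum>w\<in>F. norm (c w))) * exp (\<sigma> * t))) (I - F)"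
        using has_sum_infsum[OF sumF] unfolding tail by (rule has_sum_cmult_left)
      have le: "norm (h t - (\<Sum>w\<in>F. c w * exp (w * t))) \<le> (S - (\<Sum>w\<in>F. norm (c w))) * exp (\<sigma> * t)"
        using hs hs' nle by (rule norm_infsum_le)
      have "?r t = (h t - (\<Sum>w\<in>F. c w * exp (w * t))) * exp (u * t)"
      proof -
        have "exp (- (- (u + w)) * complex_of_real t) = exp (w * t) * exp (u * t)" for w
          by (simp add: exp_add distrib_right)
        thus ?thesis by (simp only: left_diff_distrib sum_distrib_right mult.assoc)
      qed
      hence "norm (?r t) = norm (h t - (\<Sum>w\<in>F. c w * exp (w * t))) * exp (Re u * t)"
        by (simp add: norm_mult)
      also have "\<dots> \<le> (S - (\<Sum>w\<in>F. norm (c w))) * exp (\<sigma> * t) * exp (Re u * t)"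
        by (intro mult_right_mono le) auto
      also have "\<dots> = (S - (\<Sum>w\<in>F. norm (c w))) * exp (- k * t)"
        by (simp add: k_def mult_exp_exp mult.assoc algebra_simps)
      finally show ?thesis .
    qed
    have rc: "continuous_on {0..} ?r" by (intro continuous_intros h(1))
    note r = set_lborel_dominated_exp_minus[OF k rc rb]
    have pos: "Re (- (u + w)) > 0" if "w \<in> F" for w using I[of w] that F u by auto
    have iw: "set_integrable lborel {0..} (\<lambda>t. c w * exp (- (- (u + w)) * complex_of_real t))" if "w \<in> F" for w
      using set_lborel_exp_complex_at_least_0(1)[OF pos[OF that]] by (intro set_integrable_mult_right) auto
    have Lw: "(LINT t:{0..}|lborel. c w * exp (- (- (u + w)) * complex_of_real t)) = - c w / (u + w)" if "w \<in> F" for w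
    proof -
      have "a * (1 / - b) = - a / b" for a b :: complex by simp
      thus ?thesis unfolding set_integral_mult_right set_lborel_exp_complex_at_least_0(2)[OF pos[OF that]] .
    qed
    have iF: "set_integrable lborel {0..} (\<lambda>t. \<Sum>w\<in>F. c w * exp (- (- (u + w)) * complex_of_real t))"
      unfolding set_integrable_def scaleR_sum_right
      by (intro Bochner_Integration.integrable_sum) (use iw in \<open>simp add: set_integrable_def\<close>)
    have "?L = (LINT t:{0..}|lborel. ?r t + (\<Sum>w\<in>F. c w * exp (- (- (u + w)) * complex_of_real t)))"
      by simp
    also have "\<dots> = (LINT t:{0..}|lborel. ?r t) + (LINT t:{0..}|lborel. (\<Sum>w\<in>F. c w * exp (- (- (u + w)) * complex_of_real t)))"
      by (rule set_integral_add(2)[OF r(1) iF]) auto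
    also have "(LINT t:{0..}|lborel. (\<Sum>w\<in>F. c w * exp (- (- (u + w)) * complex_of_real t))) = (\<Sum>w\<in>F. - c w / (u + w))"
    proof -
      have "(LINT t:{0..}|lborel. (\<Sum>w\<in>F. c w * exp (- (- (u + w)) * complex_of_real t))) =
            (\<Sum>w\<in>F. LINT t:{0..}|lborel. c w * exp (- (- (u + w)) * complex_of_real t))"
        unfolding set_lebesgue_integral_def scaleR_sum_right
        by (intro Bochner_Integration.integral_sum) (use iw in \<open>simp add: set_integrable_def\<close>)
      also have "\<dots> = (\<Sum>w\<in>F. - c w / (u + w))" by (intro sum.cong refl Lw)
      finally show ?thesis .
    qed
    finally have "norm ((\<Sum>w\<in>F. - c w / (u + w)) - ?L) = norm (LINT t:{0..}|lborel. ?r t)"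
      by (simp add: norm_minus_commute)
    also have "\<dots> \<le> (S - (\<Sum>w\<in>F. norm (c w))) / k" using r(2) by simp
    finally show ?thesis .
  qed
  have "((\<lambda>F. (S - (\<Sum>w\<in>F. norm (c w))) / k) \<longlongrightarrow> (S - S) / k) (finite_subsets_at_top I)"
    using has_sum_infsum[OF c] k unfolding S_def has_sum_def by (intro tendsto_intros) auto
  hence "((\<lambda>F. (S - (\<Sum>w\<in>F. norm (c w))) / k) \<longlongrightarrow> 0) (finite_subsets_at_top I)" by simp
  hence "((\<lambda>F. (\<Sum>w\<in>F. - c w / (u + w)) - ?L) \<longlongrightarrow> 0) (finite_subsets_at_top I)"
    by (rule Lim_null_comparison[rotated]) (rule eventually_finite_subsets_at_top_weakI, rule bound)
  thus ?thesis unfolding has_sum_def by (simp add: LIM_zero_iff)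
qed

text \<open>Boundedness makes the transform holomorphic on the left half plane. Far to the left it
  equals a sum of simple poles, and the identity theorem carries the equality over to the half plane
  minus the poles. A pole inside that half plane must therefore have residue 0.\<close>

theorem bounded_exponential_sum_coeff_zero:
  fixes c :: "complex \<Rightarrow> complex" and h :: "real \<Rightarrow> complex"
  assumes I: "\<And>r. finite (I \<inter> cball 0 r)" and c: "(\<lambda>w. norm (c w)) summable_on I"
    and Re_le: "\<And>w. w \<in> I \<Longrightarrow> Re w \<le> \<sigma>"
    and h: "continuous_on {0..} h" "\<And>t. t \<ge> 0 \<Longrightarrow> ((\<lambda>w. c w * exp (w * t)) has_sum h t) I"
    and B: "\<And>t. t \<ge> 0 \<Longrightarrow> norm (h t) \<le> B"
    and w: "w \<in> I" "Re w > 0"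
  shows "c w = 0"
proof -
  define T where "T = (\<lambda>u. LINT t:{0..}|lborel. h t * exp (u * complex_of_real t))"
  have T_hol: "T holomorphic_on {u. Re u < 0}"
    unfolding T_def by (rule holomorphic_on_half_line_transform[OF h(1)]) (use B in simp)
  define J where "J = uminus ` I"
  \<comment> \<open>With the kernel \<open>exp (u * t)\<close> the exponent \<open>w\<close> yields
    \<open>- c w / (u + w)\<close>, a pole at \<open>z = - w\<close> with residue
    \<open>d z\<close>; \<open>Re w > 0\<close> thus means a pole on the left.\<close>
  define d where "d = (\<lambda>z. - c (- z))"
  have J: "finite (J \<inter> cball 0 r)" for r
  proof -
    have "J \<inter> cball 0 r = uminus ` (I \<inter> cball 0 r)" by (auto simp: J_def)
    thus ?thesis using I by simp
  qed
  have dJ: "(\<lambda>z. norm (d z)) summable_on J"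
  proof -
    have "((\<lambda>z. norm (d z)) \<circ> uminus) summable_on I" using c by (simp add: d_def comp_def)
    thus ?thesis unfolding J_def by (subst summable_on_reindex) auto
  qed
  have T_sum: "T u = (\<Sum>\<^sub>\<infinity>z\<in>J. d z / (u - z))" if "Re u < - \<sigma>" for u
  proof -
    have "((\<lambda>w. - c w / (u + w)) has_sum T u) I"
      unfolding T_def by (rule exponential_sum_laplace[OF c Re_le h that])
    hence "(((\<lambda>z. d z / (u - z)) \<circ> uminus) has_sum T u) I" by (simp add: d_def comp_def)
    hence "((\<lambda>z. d z / (u - z)) has_sum T u) J" unfolding J_def by (subst has_sum_reindex) auto
    thus ?thesis by (simp add: infsumI)
  qed
  define z0 where "z0 = - w"
  have z0: "z0 \<in> J" "Re z0 < 0" using w by (auto simp: z0_def J_def)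
  define G where "G = (\<lambda>u. \<Sum>\<^sub>\<infinity>z\<in>J - {z0}. d z / (u - z))"
  have J': "finite ((J - {z0}) \<inter> cball 0 r)" for r by (rule finite_subset[OF _ J[of r]]) auto
  have G_hol: "G holomorphic_on - (J - {z0})"
    unfolding G_def by (intro simple_pole_sum_holomorphic J' summable_on_subset_banach[OF dJ]) auto
  have G_split: "(\<Sum>\<^sub>\<infinity>z\<in>J. d z / (u - z)) = d z0 / (u - z0) + G u" if "u \<notin> J" for u
  proof -
    obtain e where e: "e > 0" "\<And>w. w \<in> J \<Longrightarrow> e \<le> dist u w" using discrete_isolated_ball[OF J \<open>u \<notin> J\<close>] by blast
    have "(\<lambda>z. d z / (u - z)) summable_on J"
    proof (rule abs_summable_summable, rule summable_on_comparison_test[OF summable_on_cmult_left[OF dJ, of "inverse e"]])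
      show "norm (d z / (u - z)) \<le> norm (d z) * inverse e" if "z \<in> J" for z
        unfolding divide_inverse[symmetric] norm_divide
        using e(1) e(2)[OF that] by (intro frac_le) (auto simp: dist_norm)
    qed auto
    hence "(\<lambda>z. d z / (u - z)) summable_on (J - {z0})" by (rule summable_on_subset_banach) auto
    from infsum_insert[OF this, of z0] show ?thesis using z0 by (simp add: G_def insert_absorb)
  qed
  define S where "S = {u. Re u < 0} - J"
  have S: "open S" unfolding S_def by (intro open_Diff open_halfspace_Re_lt discrete_closed J)
  \<comment> \<open>A countable set does not disconnect a connected open subset of the
    plane.\<close>
  have conn: "connected S" unfolding S_def
    by (intro connected_open_diff_countable open_halfspace_Re_lt convex_connected convex_halfspace_Re_lt discrete_countable J) simp
  have eq: "T u = d z0 / (u - z0) + G u" if "u \<in> S" for u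
  proof -
    let ?P = "\<lambda>u. \<Sum>\<^sub>\<infinity>z\<in>J. d z / (u - z)"
    have "T u - ?P u = 0"
    \<comment> \<open>The maximum with 0 keeps the starting region inside the left half plane also
      for negative \<open>\<sigma>\<close>; being to the left of \<open>- \<sigma>\<close> keeps it
      free of poles.\<close>
    proof (rule analytic_continuation_open[of "{u. Re u < - max \<sigma> 0}" S "\<lambda>u. T u - ?P u" "\<lambda>_. 0"])
      show "open {u. Re u < - max \<sigma> 0}" by (rule open_halfspace_Re_lt)
      have "complex_of_real (- max \<sigma> 0 - 1) \<in> {u. Re u < - max \<sigma> 0}" by simp
      thus "{u. Re u < - max \<sigma> 0} \<noteq> {}" by blast
      show "{u. Re u < - max \<sigma> 0} \<subseteq> S" using Re_le by (force simp: S_def J_def)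
      have "?P holomorphic_on S"
        by (rule holomorphic_on_subset[OF simple_pole_sum_holomorphic[OF J dJ]]) (auto simp: S_def)
      thus "(\<lambda>u. T u - ?P u) holomorphic_on S"
        by (intro holomorphic_intros holomorphic_on_subset[OF T_hol]) (auto simp: S_def)
    qed (use S conn that T_sum in auto)
    thus ?thesis using G_split[of u] that by (simp add: S_def)
  qed
  \<comment> \<open>\<open>T\<close> and the sum \<open>G\<close> over the other poles are both
    continuous at \<open>z0\<close>, so this limit is 0; along the punctured neighbourhood the same
    expression is the constant \<open>d z0\<close>.\<close>
  have lim1: "((\<lambda>u. (u - z0) * (T u - G u)) \<longlongrightarrow> (z0 - z0) * (T z0 - G z0)) (at z0)"
  proof (intro tendsto_intros)
    have "isCont T z0" using holomorphic_on_imp_continuous_on[OF T_hol] z0(2)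
      by (simp add: continuous_on_eq_continuous_at[OF open_halfspace_Re_lt])
    thus "(T \<longlongrightarrow> T z0) (at z0)" by (simp add: isCont_def)
    have "isCont G z0" using holomorphic_on_imp_continuous_on[OF G_hol]
      unfolding continuous_on_eq_continuous_at[OF open_Compl[OF discrete_closed[OF J']]] by simp
    thus "(G \<longlongrightarrow> G z0) (at z0)" by (simp add: isCont_def)
  qed
  have "open ({u. Re u < 0} - (J - {z0}))"
    by (intro open_Diff open_halfspace_Re_lt discrete_closed J')
  hence "\<forall>\<^sub>F u in at z0. u \<in> {u. Re u < 0} - (J - {z0}) - {z0}"
    by (rule eventually_at_in_open) (use z0 in auto)
  hence "\<forall>\<^sub>F u in at z0. (u - z0) * (T u - G u) = d z0"
  proof eventually_elim
    case (elim u)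
    hence "T u = d z0 / (u - z0) + G u" "u \<noteq> z0" by (auto intro!: eq simp: S_def)
    thus ?case by simp
  qed
  hence "((\<lambda>u. (u - z0) * (T u - G u)) \<longlongrightarrow> d z0) (at z0)" by (rule tendsto_eventually)
  from tendsto_unique[OF _ this lim1] have "d z0 = 0" by simp
  thus ?thesis by (simp add: d_def z0_def)
qed

section \<open>The sum over the zeros\<close>

lemma continuous_on_exponential_sum:
  fixes c :: "complex \<Rightarrow> complex" and h :: "real \<Rightarrow> complex"
  assumes c: "(\<lambda>w. norm (c w)) summable_on I" and I: "\<And>w. w \<in> I \<Longrightarrow> Re w \<le> \<sigma>" and "\<sigma> \<ge> 0"
    and h: "\<And>t. t \<ge> 0 \<Longrightarrow> ((\<lambda>w. c w * exp (w * t)) has_sum h t) I"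
  shows "continuous_on {0..} h"
proof -
  have cont: "continuous_on {0..T} h" for T
  proof -
    have "uniform_limit {0..T} (\<lambda>F t. \<Sum>w\<in>F. c w * exp (w * complex_of_real t)) h (finite_subsets_at_top I)"
    proof (rule Weierstrass_m_test_general')
      show "(\<lambda>w. norm (c w) * exp (\<sigma> * T)) summable_on I" using c by (rule summable_on_cmult_left)
      show "norm (c w * exp (w * complex_of_real t)) \<le> norm (c w) * exp (\<sigma> * T)" if "w \<in> I" "t \<in> {0..T}" for w t
      proof -
        have "Re w * t \<le> \<sigma> * T" using I[OF that(1)] that(2) \<open>\<sigma> \<ge> 0\<close> by (intro mult_mono) auto
        thus ?thesis by (simp add: norm_mult mult_left_mono)
      qed
    qed (use h in auto)
    thus ?thesis
      by (rule uniform_limit_theorem[rotated])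
         (auto intro!: eventually_finite_subsets_at_top_weakI continuous_intros)
  qed
  show ?thesis unfolding continuous_on_eq_continuous_within
  proof
    fix t :: real assume "t \<in> {0..}"
    have "at t within {0..} = at t within {0..t+1}"
      by (rule at_within_nhd[of _ "{..<t+1}"]) auto
    thus "continuous (at t within {0..}) h"
      using cont[of "t + 1"] \<open>t \<in> {0..}\<close> by (auto simp: continuous_on_eq_continuous_within)
  qed
qed

text \<open>
  The real part of the sum over the zeros is a sum over the zeros and their conjugates, with
  the coefficients \<open>sym_coeff\<close>. Working with it avoids having to prove that the multiplicities of
  conjugate zeros agree.
\<close>
definition sym_zeros :: "complex set" where
  "sym_zeros = nontrivial_zeros \<union> cnj ` nontrivial_zeros"

definition sym_coeff :: "complex \<Rightarrow> complex" where
  "sym_coeff \<rho> = ((if \<rho> \<in> nontrivial_zeros then zero_coeff \<rho> else 0) +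
     cnj (if cnj \<rho> \<in> nontrivial_zeros then zero_coeff (cnj \<rho>) else 0)) / 2"

lemma cnj_image_iff: "z \<in> cnj ` A \<longleftrightarrow> cnj z \<in> A"
  by (metis complex_cnj_cnj image_iff)

text \<open>\<open>Re S\<close> is the mean of \<open>S\<close> and its conjugate. Both are extended
  by zero coefficients to the symmetric set, and the conjugate sum is reindexed by
  conjugation.\<close>

lemma sym_zeros_has_sum:
  fixes f :: "complex \<Rightarrow> complex"
  assumes f: "((\<lambda>\<rho>. zero_coeff \<rho> * f \<rho>) has_sum S) nontrivial_zeros" and f_cnj: "\<And>\<rho>. f (cnj \<rho>) = cnj (f \<rho>)"
  shows "((\<lambda>\<rho>. sym_coeff \<rho> * f \<rho>) has_sum of_real (Re S)) sym_zeros"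
proof -
  let ?a = "\<lambda>\<rho>. if \<rho> \<in> nontrivial_zeros then zero_coeff \<rho> else 0"
  have 1: "((\<lambda>\<rho>. ?a \<rho> * f \<rho>) has_sum S) sym_zeros"
    using f by (rule has_sum_cong_neutral[THEN iffD1, rotated -1]) (auto simp: sym_zeros_def)
  have "((\<lambda>\<rho>. cnj (?a \<rho> * f \<rho>)) has_sum cnj S) sym_zeros" using 1 by (simp only: has_sum_cnj_iff)
  hence "((\<lambda>\<rho>. cnj (?a (cnj \<rho>)) * f \<rho>) \<circ> cnj has_sum cnj S) sym_zeros"
    by (simp only: comp_def f_cnj complex_cnj_cnj complex_cnj_mult)
  hence "((\<lambda>\<rho>. cnj (?a (cnj \<rho>)) * f \<rho>) has_sum cnj S) (cnj ` sym_zeros)"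
    by (subst has_sum_reindex) (auto simp: inj_on_def)
  also have "cnj ` sym_zeros = sym_zeros" by (auto simp: sym_zeros_def cnj_image_iff)
  finally have "((\<lambda>\<rho>. (?a \<rho> * f \<rho> + cnj (?a (cnj \<rho>)) * f \<rho>) * (1/2)) has_sum ((S + cnj S) * (1/2))) sym_zeros"
    by (intro has_sum_cmult_left has_sum_add 1)
  moreover have "(S + cnj S) * (1/2) = of_real (Re S)" by (simp add: complex_add_cnj)
  moreover have "(\<lambda>\<rho>. (?a \<rho> * f \<rho> + cnj (?a (cnj \<rho>)) * f \<rho>) * (1/2)) = (\<lambda>\<rho>. sym_coeff \<rho> * f \<rho>)"
  proof
    fix \<rho>
    have "(x * z + y * z) * (1/2) = (x + y) / 2 * z" for x y z :: complex by (simp add: field_simps)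
    thus "(?a \<rho> * f \<rho> + cnj (?a (cnj \<rho>)) * f \<rho>) * (1/2) = sym_coeff \<rho> * f \<rho>"
      unfolding sym_coeff_def .
  qed
  ultimately show ?thesis by simp
qed

lemma sym_coeff_summable: "(\<lambda>\<rho>. norm (sym_coeff \<rho>)) summable_on sym_zeros"
proof -
  let ?a = "\<lambda>\<rho>. if \<rho> \<in> nontrivial_zeros then norm (zero_coeff \<rho>) else 0"
  have 1: "?a summable_on sym_zeros"
    using zero_coeff_summable by (rule summable_on_cong_neutral[THEN iffD1, rotated -1]) (auto simp: sym_zeros_def)
  hence "((\<lambda>\<rho>. ?a (cnj \<rho>)) \<circ> cnj) summable_on sym_zeros" by (simp only: comp_def complex_cnj_cnj)
  hence "(\<lambda>\<rho>. ?a (cnj \<rho>)) summable_on (cnj ` sym_zeros)"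
    by (subst summable_on_reindex) (auto simp: inj_on_def)
  also have "cnj ` sym_zeros = sym_zeros" by (auto simp: sym_zeros_def cnj_image_iff)
  finally have "(\<lambda>\<rho>. ?a \<rho> + ?a (cnj \<rho>)) summable_on sym_zeros" by (intro summable_on_add 1)
  thus ?thesis
  proof (rule summable_on_comparison_test)
    fix \<rho>
    define A B where "A = (if \<rho> \<in> nontrivial_zeros then zero_coeff \<rho> else 0)"
      and "B = (if cnj \<rho> \<in> nontrivial_zeros then zero_coeff (cnj \<rho>) else 0)"
    have "norm (sym_coeff \<rho>) = norm (A + cnj B) / 2" by (simp only: sym_coeff_def A_def B_def norm_divide norm_numeral)
    also have "\<dots> \<le> (norm A + norm B) / 2" using norm_triangle_ineq[of A "cnj B"] by simp
    also have "norm A = ?a \<rho>" by (simp add: A_def)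
    also have "norm B = ?a (cnj \<rho>)" by (simp add: B_def)
    finally have "norm (sym_coeff \<rho>) \<le> (?a \<rho> + ?a (cnj \<rho>)) / 2" .
    also have "(?a \<rho> + ?a (cnj \<rho>)) / 2 \<le> ?a \<rho> + ?a (cnj \<rho>)"
    proof -
      have "x / 2 \<le> x" if "x \<ge> 0" for x :: real using that by simp
      thus ?thesis by (simp add: add_nonneg_nonneg)
    qed
    finally show "norm (sym_coeff \<rho>) \<le> ?a \<rho> + ?a (cnj \<rho>)" .
  qed auto
qed

text \<open>Conjugating the coefficient at \<open>cnj \<rho>\<close> restores the denominator
  \<open>\<rho> * (\<rho> + 1)\<close>, so the numerators add: a positive order plus one that is at
  least 0.\<close>

lemma sym_coeff_nonzero:
  assumes \<rho>: "\<rho> \<in> nontrivial_zeros"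
  shows "sym_coeff \<rho> \<noteq> 0"
proof -
  define m where "m = (if cnj \<rho> \<in> nontrivial_zeros then zorder zeta (cnj \<rho>) else 0)"
  have m: "zorder zeta \<rho> > 0" "m \<ge> 0"
    using zorder_nontrivial_zero_pos[OF \<rho>] zorder_nontrivial_zero_pos[of "cnj \<rho>"] by (auto simp: m_def)
  have "Re \<rho> > 0" using \<rho> by (simp add: nontrivial_zeros_def)
  hence "\<rho> \<noteq> 0" "\<rho> + 1 \<noteq> 0" by (auto simp: complex_eq_iff)
  hence ne: "\<rho> * (\<rho> + 1) \<noteq> 0" by simp
  have "sym_coeff \<rho> = of_int (zorder zeta \<rho> + m) / (\<rho> * (\<rho> + 1)) / 2"
    using \<rho> by (simp add: sym_coeff_def zero_coeff_def m_def add_divide_distrib)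
  moreover have "zorder zeta \<rho> + m \<noteq> 0" using m by simp
  hence "complex_of_int (zorder zeta \<rho> + m) \<noteq> 0" by (simp only: of_int_eq_0_iff not_False_eq_True)
  ultimately show ?thesis using ne by simp
qed

lemma H_exp_has_sum:
  assumes t: "t \<ge> 0"
  shows "((\<lambda>\<rho>. sym_coeff \<rho> * exp ((\<rho> - 1 / 2) * of_real t)) has_sum of_real (H (exp t))) sym_zeros"
proof -
  let ?f = "\<lambda>\<rho>. exp ((\<rho> - 1 / 2) * complex_of_real t)"
  let ?S = "\<Sum>\<^sub>\<infinity>\<rho>\<in>nontrivial_zeros. zero_coeff \<rho> * ?f \<rho>"
  have "(\<lambda>\<rho>. norm (zero_coeff \<rho>) * exp t) summable_on nontrivial_zeros"
    using zero_coeff_summable by (rule summable_on_cmult_left)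
  hence "(\<lambda>\<rho>. norm (zero_coeff \<rho> * ?f \<rho>)) summable_on nontrivial_zeros"
  proof (rule summable_on_comparison_test)
    fix \<rho> assume "\<rho> \<in> nontrivial_zeros"
    hence "(Re \<rho> - 1 / 2) * t \<le> 1 * t" using t by (intro mult_right_mono) (auto simp: nontrivial_zeros_def)
    thus "norm (zero_coeff \<rho> * ?f \<rho>) \<le> norm (zero_coeff \<rho>) * exp t"
      by (simp add: norm_mult mult_left_mono)
  qed auto
  hence "((\<lambda>\<rho>. zero_coeff \<rho> * ?f \<rho>) has_sum ?S) nontrivial_zeros"
    by (rule has_sum_infsum[OF abs_summable_summable])
  moreover have "?f (cnj \<rho>) = cnj (?f \<rho>)" for \<rho>
    unfolding exp_cnj by (rule arg_cong[of _ _ exp]) simp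
  ultimately have "((\<lambda>\<rho>. sym_coeff \<rho> * ?f \<rho>) has_sum of_real (Re ?S)) sym_zeros"
    by (rule sym_zeros_has_sum)
  moreover have "H (exp t) = Re ?S"
  proof -
    have "complex_of_real (exp t) powr w = exp (w * of_real t)" for w
      by (simp add: powr_def Ln_of_real)
    hence "of_int (zorder zeta \<rho>) * (complex_of_real (exp t) powr (\<rho> - 1 / 2) / (\<rho> * (\<rho> + 1))) = zero_coeff \<rho> * ?f \<rho>" for \<rho>
      by (simp only: zero_coeff_def times_divide_eq_right times_divide_eq_left)
    thus ?thesis unfolding H_def by simp
  qed
  ultimately show ?thesis by simp
qed

definition sym_exponents :: "complex set" where
  "sym_exponents = (\<lambda>\<rho>. \<rho> - 1 / 2) ` sym_zeros"

lemma sym_exponents_finite: "finite (sym_exponents \<inter> cball 0 r)"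
proof (rule finite_subset)
  let ?F = "nontrivial_zeros \<inter> cball 0 (r + 1)"
  show "sym_exponents \<inter> cball 0 r \<subseteq> (\<lambda>\<rho>. \<rho> - 1 / 2) ` (?F \<union> cnj ` ?F)"
  proof
    fix w assume w: "w \<in> sym_exponents \<inter> cball 0 r"
    then obtain \<rho> where \<rho>: "\<rho> \<in> sym_zeros" "w = \<rho> - 1 / 2" by (auto simp: sym_exponents_def)
    have "norm \<rho> \<le> norm w + norm (1 / 2 :: complex)"
      using norm_triangle_ineq[of w "1 / 2"] by (simp add: \<rho>(2))
    hence "norm \<rho> \<le> r + 1" using w by simp
    thus "w \<in> (\<lambda>\<rho>. \<rho> - 1 / 2) ` (?F \<union> cnj ` ?F)"
      using \<rho> by (auto simp: sym_zeros_def)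
  qed
qed (use finite_nontrivial_zeros_cball in auto)

lemma H_exp_exponential_sum:
  shows "(\<lambda>w. norm (sym_coeff (w + 1 / 2))) summable_on sym_exponents"
    and "t \<ge> 0 \<Longrightarrow> ((\<lambda>w. sym_coeff (w + 1 / 2) * exp (w * of_real t)) has_sum of_real (H (exp t))) sym_exponents"
    and "w \<in> sym_exponents \<Longrightarrow> Re w \<le> 1 / 2"
proof -
  have inj: "inj_on (\<lambda>\<rho>. \<rho> - 1 / 2) (sym_zeros)" by (auto simp: inj_on_def)
  show "(\<lambda>w. norm (sym_coeff (w + 1 / 2))) summable_on sym_exponents"
    unfolding sym_exponents_def summable_on_reindex[OF inj] comp_def using sym_coeff_summable by simp
  show "t \<ge> 0 \<Longrightarrow> ((\<lambda>w. sym_coeff (w + 1 / 2) * exp (w * of_real t)) has_sum of_real (H (exp t))) sym_exponents"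
    unfolding sym_exponents_def has_sum_reindex[OF inj] comp_def using H_exp_has_sum by simp
  show "w \<in> sym_exponents \<Longrightarrow> Re w \<le> 1 / 2"
    by (auto simp: sym_exponents_def sym_zeros_def nontrivial_zeros_def)
qed

lemma continuous_on_H_exp: "continuous_on {0..} (\<lambda>t. H (exp t))"
proof -
  have "continuous_on {0..} (\<lambda>t. complex_of_real (H (exp t)))"
    by (rule continuous_on_exponential_sum[OF H_exp_exponential_sum(1) H_exp_exponential_sum(3) _ H_exp_exponential_sum(2)]) auto
  from continuous_on_Re[OF this] show ?thesis by simp
qed

theorem riemann_hypothesis_if_H_bounded:
  assumes "bounded ((\<lambda>t. H (exp t)) ` {0..})"
  shows riemann_hypothesis
proof -
  obtain B where B: "\<And>t. t \<ge> 0 \<Longrightarrow> \<bar>H (exp t)\<bar> \<le> B" using assms by (auto simp: bounded_iff)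
  have le: "Re \<rho> \<le> 1 / 2" if \<rho>: "\<rho> \<in> nontrivial_zeros" for \<rho>
  proof (rule ccontr)
    assume "\<not> Re \<rho> \<le> 1 / 2"
    have "sym_coeff (\<rho> - 1 / 2 + 1 / 2) = 0"
    proof (rule bounded_exponential_sum_coeff_zero[where c = "\<lambda>w. sym_coeff (w + 1 / 2)" and h = "\<lambda>t. of_real (H (exp t))"])
      show "continuous_on {0..} (\<lambda>t. complex_of_real (H (exp t)))"
        by (intro continuous_intros continuous_on_H_exp)
      show "\<rho> - 1 / 2 \<in> sym_exponents" using \<rho> by (auto simp: sym_exponents_def sym_zeros_def)
      show "Re (\<rho> - 1 / 2) > 0" using \<open>\<not> Re \<rho> \<le> 1 / 2\<close> by simp
      show "norm (complex_of_real (H (exp t))) \<le> B" if "t \<ge> 0" for t using B[OF that] by simp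
    qed (fact sym_exponents_finite H_exp_exponential_sum)+
    with sym_coeff_nonzero[OF \<rho>] show False by simp
  qed
  show ?thesis unfolding riemann_hypothesis_def
  proof
    fix \<rho> assume "\<rho> \<in> nontrivial_zeros"
    from le[OF this] le[OF nontrivial_zeros_reflect[OF this]] show "Re \<rho> = 1 / 2" by simp
  qed
qed

theorem theorem1p2:
  assumes "\<exists>M_H :: real \<Rightarrow> real.
    continuous_on UNIV M_H \<and> compact (closure {u. M_H u \<noteq> 0}) \<and>
    (\<forall>\<Phi> :: real \<Rightarrow> complex. locally_riemann_integrable \<Phi> \<longrightarrow>
       ((\<lambda>T :: real. 1 / of_real T * integral {0..T} (\<lambda>t. \<Phi> (H (exp t)))) \<longlongrightarrow>
          1 / of_real (sqrt (2 * pi)) * integral UNIV (\<lambda>u. of_real (M_H u) * \<Phi> u)) at_top)"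
  shows "bounded (H ` {1..}) \<and> riemann_hypothesis"
proof -
  obtain M_H :: "real \<Rightarrow> real" where M: "compact (closure {u. M_H u \<noteq> 0})"
    and lim: "\<And>\<Phi> :: real \<Rightarrow> complex. locally_riemann_integrable \<Phi> \<Longrightarrow>
       ((\<lambda>T :: real. 1 / of_real T * integral {0..T} (\<lambda>t. \<Phi> (H (exp t)))) \<longlongrightarrow>
          1 / of_real (sqrt (2 * pi)) * integral UNIV (\<lambda>u. of_real (M_H u) * \<Phi> u)) at_top"
    using assms by blast
  have "bounded {u. M_H u \<noteq> 0}"
    using bounded_subset[OF compact_imp_bounded[OF M] closure_subset] .
  then obtain K where K: "\<And>u. M_H u \<noteq> 0 \<Longrightarrow> \<bar>u\<bar> \<le> K" by (auto simp: bounded_iff)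
  have bdd: "bounded ((\<lambda>t. H (exp t)) ` {0..})"
  \<comment> \<open>\<open>K\<close> bounds the support of \<open>M_H\<close>. For a test function
    vanishing on \<open>\<bar>u\<bar> \<le> K\<close> the product with \<open>M_H\<close> is
    identically 0, so the assumed limit of the averages is 0; the rest transfers it from complex to
    real values.\<close>
  proof (rule bounded_of_vanishing_averages[OF continuous_on_H_exp])
    fix \<Phi> :: "real \<Rightarrow> real"
    assume \<Phi>: "continuous_on UNIV \<Phi>" "\<And>u. \<bar>u\<bar> \<le> K \<Longrightarrow> \<Phi> u = 0"
    let ?\<Phi> = "\<lambda>u. complex_of_real (\<Phi> u)"
    have "locally_riemann_integrable ?\<Phi>"
      unfolding locally_riemann_integrable_def
      by (intro allI impI continuous_imp_riemann_integrable continuous_intros continuous_on_subset[OF \<Phi>(1)]) auto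
    note lim[OF this]
    moreover have "(\<lambda>u. of_real (M_H u) * ?\<Phi> u) = (\<lambda>_. 0)"
    proof
      fix u show "of_real (M_H u) * ?\<Phi> u = 0"
        using K[of u] \<Phi>(2)[of u] by (cases "M_H u = 0") auto
    qed
    ultimately have "((\<lambda>T. 1 / of_real T * integral {0..T} (\<lambda>t. ?\<Phi> (H (exp t)))) \<longlongrightarrow> 0) at_top" by simp
    moreover have "integral {0..T} (\<lambda>t. ?\<Phi> (H (exp t))) = of_real (integral {0..T} (\<lambda>t. \<Phi> (H (exp t))))" for T
    proof -
      have "(\<lambda>t. \<Phi> (H (exp t))) integrable_on {0..T}"
        by (intro integrable_continuous_interval continuous_on_compose2[OF \<Phi>(1)] continuous_on_subset[OF continuous_on_H_exp]) auto
      thus ?thesis by (intro integral_unique has_integral_of_real integrable_integral)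
    qed
    ultimately have "((\<lambda>T. complex_of_real (1 / T * integral {0..T} (\<lambda>t. \<Phi> (H (exp t))))) \<longlongrightarrow> of_real 0) at_top"
      by simp
    thus "((\<lambda>T. 1 / T * integral {0..T} (\<lambda>t. \<Phi> (H (exp t)))) \<longlongrightarrow> 0) at_top"
      by (simp only: tendsto_of_real_iff)
  qed
  have "{1..} = exp ` {0 :: real..}"
  proof (intro equalityI subsetI)
    fix x :: real assume "x \<in> {1..}"
    thus "x \<in> exp ` {0..}" by (intro image_eqI[of _ _ "ln x"]) auto
  qed auto
  hence "H ` {1..} = (\<lambda>t. H (exp t)) ` {0..}" by (simp add: image_image)
  with bdd riemann_hypothesis_if_H_bounded[OF bdd] show ?thesis by simp
qed

end
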